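(* Let $n>5$, and let $\phi\colon vB_n\to G$ be a group homomorphism to a finite group $G$. One of the following must be true: \begin{enumerate} \item $\phi$ is abelian. \item $\phi$ factors through $wB_n$ (the induced homomorphism $wB_n\to G$ is also denoted $\phi$), and either \begin{enumerate} \item $\phi$ restricted to $PwB_n$ is cyclic. \item $|\phi(vB_n)|\ge 2^{n-2}(n-1)!$. \item For all $i$ and $j$, $\phi$ does not split $A_i$, $\phi(A_i)^2\neq\phi(A_j)^2$, and \[ |\phi(vB_n)|\ \geq\ \left(\left\lfloor\frac n2\right\rfloor+1\right)\left(3^{\lfloor \frac n2\rfloor-1}\right)\left\lceil\frac n2\right\rceil!\,. \] \end{enumerate} \item $\phi$ does not factor through $wB_n$ and \[ |\phi(vB_n)|\ \geq\ \left(\left\lfloor\frac n2\right\rfloor+1\right)\left(3^{\lfloor \frac n2\rfloor-1}\right)\left\lceil\frac n2\right\rceil!\,. \] \end{enumerate}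
   Context: A homomorphism is called cyclic (resp. abelian) if its image is a cyclic (resp. abelian) group. A homomorphism $\phi$ splits a set $S$ if $|\phi(S)|=|S|$. For the sets $A_i$ below, $|\phi(A_i)|$ is always either $1$ or $|A_i|$, so $\phi$ not splitting $A_i$ means that $\phi$ maps $A_i$ to a single element, which is then also denoted $\phi(A_i)$. The virtual braid group $vB_n$ has generators $\sigma_1,\dots,\sigma_{n-1},\tau_1,\dots,\tau_{n-1}$ and relations: (1) $\sigma_i\sigma_j=\sigma_j\sigma_i$ for $|i-j|>1$; (2) $\sigma_i\sigma_{i+1}\sigma_i=\sigma_{i+1}\sigma_i\sigma_{i+1}$ for $1\le i\le n-2$; (3) $\tau_i^2=1$ for $1\le i\le n-1$; (4) $\tau_i\tau_j=\tau_j\tau_i$ for $|i-j|>1$; (5) $\tau_i\tau_{i+1}\tau_i=\tau_{i+1}\tau_i\tau_{i+1}$ for $1\le i\le n-2$; (6) $\sigma_i\tau_j=\tau_j\sigma_i$ for $|i-j|>1$; (7) $\tau_{i+1}\sigma_i\tau_{i+1}=\tau_i\sigma_{i+1}\tau_i$ for $1\le i\le n-2$. The welded braid group $wB_n$ is the quotient of $vB_n$ by the additional relations $\tau_i\sigma_{i+1}\sigma_i=\sigma_{i+1}\sigma_i\tau_{i+1}$ for $1\le i\le n-2$. For distinct $i,j\in\{1,\dots,n\}$, define $\sigma_{i,j}=\tau_i\tau_{i+1}\cdots\tau_{j-2}\,\tau_{j-1}\sigma_{j-1}\,\tau_{j-2}\cdots\tau_{i+1}\tau_i$ if $i<j$,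 and $\sigma_{i,j}=\tau_{i-1}\tau_{i-2}\cdots\tau_{j+1}\,\sigma_j\tau_j\,\tau_{j+1}\cdots\tau_{i-2}\tau_{i-1}$ if $j<i$ (so $\sigma_{i,i+1}=\tau_i\sigma_i$ and $\sigma_{i+1,i}=\sigma_i\tau_i$). For each $i\in\{1,\dots,n\}$, $A_i=\{\sigma_{i,j}: 1\le j\le n,\ j\ne i\}\subseteq wB_n$. The pure welded braid group $PwB_n$ is the subgroup of $wB_n$ generated by all $\sigma_{i,j}$ with $i\neq j$. *)

theory Defs
  imports Complex_Main "HOL-Algebra.Elementary_Groups"
begin

section \<open>Groups given by generators and relations\<close>

text \<open>A letter \<open>(True, x)\<close> stands for the generator \<open>x\<close> and \<open>(False, x)\<close> for its formal inverse.
  A pair \<open>(u, v)\<close> of words stands for the relation \<open>u = v\<close>.\<close>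

type_synonym 'a gword = "(bool \<times> 'a) list"

definition gwords :: "'a set \<Rightarrow> 'a gword set" where
  "gwords X = {w. snd ` set w \<subseteq> X}"

inductive_set pres_rel :: "'a set \<Rightarrow> ('a gword \<times> 'a gword) set \<Rightarrow> ('a gword \<times> 'a gword) set"
  for X R where
  pres_refl: "w \<in> gwords X \<Longrightarrow> (w, w) \<in> pres_rel X R"
| pres_sym: "(u, v) \<in> pres_rel X R \<Longrightarrow> (v, u) \<in> pres_rel X R"
| pres_trans: "(u, v) \<in> pres_rel X R \<Longrightarrow> (v, w) \<in> pres_rel X R \<Longrightarrow> (u, w) \<in> pres_rel X R"
| pres_mult: "(u, v) \<in> pres_rel X R \<Longrightarrow> (u', v') \<in> pres_rel X R \<Longrightarrow> (u @ u', v @ v') \<in> pres_rel X R"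
| pres_cancel: "x \<in> X \<Longrightarrow> ([(b, x), (\<not> b, x)], []) \<in> pres_rel X R"
| pres_relation: "(u, v) \<in> R \<Longrightarrow> u \<in> gwords X \<Longrightarrow> v \<in> gwords X \<Longrightarrow> (u, v) \<in> pres_rel X R"

definition pres_class :: "'a set \<Rightarrow> ('a gword \<times> 'a gword) set \<Rightarrow> 'a gword \<Rightarrow> 'a gword set" where
  "pres_class X R w = pres_rel X R `` {w}"

definition presented_group ::
  "'a set \<Rightarrow> ('a gword \<times> 'a gword) set \<Rightarrow> 'a gword set monoid" where
  "presented_group X R =
    \<lparr>carrier = gwords X // pres_rel X R,
     mult = (\<lambda>A B. \<Union>u\<in>A. \<Union>v\<in>B. pres_class X R (u @ v)),
     one = pres_class X R []\<rparr>"

lemma gwords_simps [simp]: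
  "[] \<in> gwords X"
  "l # w \<in> gwords X \<longleftrightarrow> snd l \<in> X \<and> w \<in> gwords X"
  "u @ v \<in> gwords X \<longleftrightarrow> u \<in> gwords X \<and> v \<in> gwords X"
  by (auto simp: gwords_def)

lemma pres_rel_gwords: "(u, v) \<in> pres_rel X R \<Longrightarrow> u \<in> gwords X \<and> v \<in> gwords X"
  by (induction rule: pres_rel.induct) auto

lemma equiv_pres_rel: "equiv (gwords X) (pres_rel X R)"
proof (rule equivI)
  show "pres_rel X R \<subseteq> gwords X \<times> gwords X"
    using pres_rel_gwords by fastforce
  show "refl_on (gwords X) (pres_rel X R)"
    by (auto simp: refl_on_def intro: pres_refl)
  show "sym (pres_rel X R)"
    by (auto intro: symI pres_sym)
  show "trans (pres_rel X R)"
    by (auto intro: transI pres_trans)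
qed

lemma pres_class_eq_iff:
  "u \<in> gwords X \<Longrightarrow> v \<in> gwords X \<Longrightarrow>
    pres_class X R u = pres_class X R v \<longleftrightarrow> (u, v) \<in> pres_rel X R"
  unfolding pres_class_def using eq_equiv_class_iff[OF equiv_pres_rel] by fast

lemma carrier_presented_group: "carrier (presented_group X R) = pres_class X R ` gwords X"
  by (auto simp: presented_group_def quotient_def pres_class_def)

lemma one_presented_group: "\<one>\<^bsub>presented_group X R\<^esub> = pres_class X R []"
  by (simp add: presented_group_def)

lemma mult_presented_group:
  assumes "u \<in> gwords X" "v \<in> gwords X"
  shows "pres_class X R u \<otimes>\<^bsub>presented_group X R\<^esub> pres_class X R v = pres_class X R (u @ v)"
proof -
  have "pres_class X R (u' @ v') = pres_class X R (u @ v)"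
    if "u' \<in> pres_class X R u" "v' \<in> pres_class X R v" for u' v'
  proof -
    have "(u, u') \<in> pres_rel X R" "(v, v') \<in> pres_rel X R"
      using that by (auto simp: pres_class_def)
    then have "(u @ v, u' @ v') \<in> pres_rel X R"
      by (rule pres_mult)
    then show ?thesis
      unfolding pres_class_def using equiv_class_eq[OF equiv_pres_rel] by metis
  qed
  moreover have "u \<in> pres_class X R u" "v \<in> pres_class X R v"
    using assms by (auto simp: pres_class_def intro: pres_refl)
  ultimately have "(\<Union>u'\<in>pres_class X R u. \<Union>v'\<in>pres_class X R v. pres_class X R (u' @ v'))
      = pres_class X R (u @ v)"
    by blast
  then show ?thesis
    by (simp add: presented_group_def)
qed

lemma pres_inverse:
  "w \<in> gwords X \<Longrightarrow> (rev (map (\<lambda>(b, x). (\<not> b, x)) w) @ w, []) \<in> pres_rel X R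
     \<and> rev (map (\<lambda>(b, x). (\<not> b, x)) w) \<in> gwords X"
proof (induction w)
  case Nil
  then show ?case by (simp add: pres_refl)
next
  case (Cons l w)
  obtain b x where l: "l = (b, x)" by force
  let ?i = "rev (map (\<lambda>(b, x). (\<not> b, x)) w)"
  have x: "x \<in> X" and w: "w \<in> gwords X" using Cons.prems l by auto
  have i: "?i \<in> gwords X" "(?i @ w, []) \<in> pres_rel X R" using Cons.IH w by auto
  have "([(\<not> b, x), (b, x)], []) \<in> pres_rel X R"
    using pres_cancel[OF x, of "\<not> b"] by simp
  then have "(?i @ ([(\<not> b, x), (b, x)] @ w), ?i @ ([] @ w)) \<in> pres_rel X R"
    by (intro pres_mult pres_refl w i(1))
  then have "(?i @ ([(\<not> b, x), (b, x)] @ w), []) \<in> pres_rel X R"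
    using pres_trans i(2) by fastforce
  then show ?case using l i x by simp
qed

lemma group_presented_group: "group (presented_group X R)"
proof (rule groupI)
  fix A assume "A \<in> carrier (presented_group X R)"
  then obtain w where w: "w \<in> gwords X" "A = pres_class X R w"
    by (auto simp: carrier_presented_group)
  let ?i = "rev (map (\<lambda>(b, x). (\<not> b, x)) w)"
  have "pres_class X R ?i \<otimes>\<^bsub>presented_group X R\<^esub> A = \<one>\<^bsub>presented_group X R\<^esub>"
    using pres_inverse[OF w(1), of R] w
    by (simp add: mult_presented_group one_presented_group pres_class_eq_iff)
  then show "\<exists>B\<in>carrier (presented_group X R).
      B \<otimes>\<^bsub>presented_group X R\<^esub> A = \<one>\<^bsub>presented_group X R\<^esub>"
    using pres_inverse[OF w(1), of R] by (auto simp: carrier_presented_group)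
qed (auto simp: carrier_presented_group mult_presented_group one_presented_group)

definition word_value :: "('g, 'm) monoid_scheme \<Rightarrow> ('a \<Rightarrow> 'g) \<Rightarrow> 'a gword \<Rightarrow> 'g" where
  "word_value G f w =
    foldr (\<lambda>(b, x) g. (if b then f x else inv\<^bsub>G\<^esub> (f x)) \<otimes>\<^bsub>G\<^esub> g) w \<one>\<^bsub>G\<^esub>"

lemma presented_group_universal:
  fixes G (structure)
  assumes "group G" and f: "f ` X \<subseteq> carrier G"
    and R: "\<And>u v. (u, v) \<in> R \<Longrightarrow> word_value G f u = word_value G f v"
  shows "\<exists>h \<in> hom (presented_group X R) G. \<forall>x\<in>X. h (pres_class X R [(True, x)]) = f x"
proof -
  interpret group G by fact
  have fx: "f x \<in> carrier G" if "x \<in> X" for x using f that by blast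
  have cl: "word_value G f w \<in> carrier G" if "w \<in> gwords X" for w
    using that by (induction w) (auto simp: word_value_def fx)
  have app: "word_value G f (u @ v) = word_value G f u \<otimes> word_value G f v"
    if "u \<in> gwords X" "v \<in> gwords X" for u v
    using that
  proof (induction u)
    case Nil
    then show ?case using cl by (simp add: word_value_def)
  next
    case (Cons l u)
    obtain b x where l: "l = (b, x)" by force
    have *: "word_value G f ((b, x) # w) = (if b then f x else inv (f x)) \<otimes> word_value G f w" for w
      by (simp add: word_value_def l)
    show ?case using Cons l cl fx by (simp add: * m_assoc)
  qed
  have eq: "word_value G f u = word_value G f v" if "(u, v) \<in> pres_rel X R" for u v
    using that
  proof (induction rule: pres_rel.induct)
    case (pres_mult u v u' v')
    then show ?case using pres_rel_gwords app by metis
  next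
    case (pres_cancel x b)
    then show ?case using fx by (simp add: word_value_def)
  qed (auto simp: R)
  define h where "h A = word_value G f (SOME w. w \<in> A)" for A
  have h: "h (pres_class X R w) = word_value G f w" if "w \<in> gwords X" for w
  proof -
    have "w \<in> pres_class X R w" using that by (simp add: pres_class_def pres_refl)
    then have "(SOME u. u \<in> pres_class X R w) \<in> pres_class X R w" by (rule someI)
    then show ?thesis using eq by (simp add: h_def pres_class_def)
  qed
  have "h \<in> hom (presented_group X R) G"
    by (auto simp: hom_def carrier_presented_group mult_presented_group h cl app)
  moreover have "h (pres_class X R [(True, x)]) = f x" if "x \<in> X" for x
    using that fx by (simp add: h) (simp add: word_value_def)
  ultimately show ?thesis by blast
qed


section \<open>Virtual and welded braid groups\<close>

datatype vgen = Sigma_gen nat | Tau_gen nat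

type_synonym vbraid = "vgen gword set"

abbreviation sg :: "nat \<Rightarrow> bool \<times> vgen" where "sg i \<equiv> (True, Sigma_gen i)"
abbreviation tu :: "nat \<Rightarrow> bool \<times> vgen" where "tu i \<equiv> (True, Tau_gen i)"

definition vB_gens :: "nat \<Rightarrow> vgen set" where
  "vB_gens n = Sigma_gen ` {1..n - 1} \<union> Tau_gen ` {1..n - 1}"

definition far :: "nat \<Rightarrow> nat \<Rightarrow> nat \<Rightarrow> bool" where
  "far n i j \<longleftrightarrow> i \<in> {1..n - 1} \<and> j \<in> {1..n - 1} \<and> \<bar>int i - int j\<bar> > 1"

definition vB_rels :: "nat \<Rightarrow> (vgen gword \<times> vgen gword) set" where
  "vB_rels n =
     {([sg i, sg j], [sg j, sg i]) | i j. far n i j}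
   \<union> {([sg i, sg (i + 1), sg i], [sg (i + 1), sg i, sg (i + 1)]) | i. i \<in> {1..n - 2}}
   \<union> {([tu i, tu i], []) | i. i \<in> {1..n - 1}}
   \<union> {([tu i, tu j], [tu j, tu i]) | i j. far n i j}
   \<union> {([tu i, tu (i + 1), tu i], [tu (i + 1), tu i, tu (i + 1)]) | i. i \<in> {1..n - 2}}
   \<union> {([sg i, tu j], [tu j, sg i]) | i j. far n i j}
   \<union> {([tu (i + 1), sg i, tu (i + 1)], [tu i, sg (i + 1), tu i]) | i. i \<in> {1..n - 2}}"

definition vB :: "nat \<Rightarrow> vbraid monoid" where
  "vB n = presented_group (vB_gens n) (vB_rels n)"

definition vB_word :: "nat \<Rightarrow> vgen gword \<Rightarrow> vbraid" where
  "vB_word n w = pres_class (vB_gens n) (vB_rels n) w"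

definition normal_closure :: "('g, 'm) monoid_scheme \<Rightarrow> 'g set \<Rightarrow> 'g set" where
  "normal_closure G S =
     generate G {g \<otimes>\<^bsub>G\<^esub> s \<otimes>\<^bsub>G\<^esub> inv\<^bsub>G\<^esub> g | g s. g \<in> carrier G \<and> s \<in> S}"

definition welded_relators :: "nat \<Rightarrow> vbraid set" where
  "welded_relators n =
     {vB_word n [tu i, sg (i + 1), sg i]
        \<otimes>\<^bsub>vB n\<^esub> inv\<^bsub>vB n\<^esub> vB_word n [sg (i + 1), sg i, tu (i + 1)] | i. i \<in> {1..n - 2}}"

definition welded_kernel :: "nat \<Rightarrow> vbraid set" where
  "welded_kernel n = normal_closure (vB n) (welded_relators n)"

definition wB :: "nat \<Rightarrow> vbraid set monoid" where
  "wB n = vB n Mod welded_kernel n"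

definition wB_proj :: "nat \<Rightarrow> vbraid \<Rightarrow> vbraid set" where
  "wB_proj n x = welded_kernel n #>\<^bsub>vB n\<^esub> x"

text \<open>The intervals \<open>[i..<j - 1]\<close> and \<open>[j + 1..<i]\<close> list \<open>i, \<dots>, j - 2\<close> and \<open>j + 1, \<dots>, i - 1\<close>.
  The value for \<open>i = j\<close> is irrelevant.\<close>

definition sigma_pair_word :: "nat \<Rightarrow> nat \<Rightarrow> vgen gword" where
  "sigma_pair_word i j =
    (if i < j
     then map tu [i..<j - 1] @ [tu (j - 1), sg (j - 1)] @ map tu (rev [i..<j - 1])
     else map tu (rev [j + 1..<i]) @ [sg j, tu j] @ map tu [j + 1..<i])"

definition sigma_pair :: "nat \<Rightarrow> nat \<Rightarrow> nat \<Rightarrow> vbraid set" where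
  "sigma_pair n i j = wB_proj n (vB_word n (sigma_pair_word i j))"

definition A_set :: "nat \<Rightarrow> nat \<Rightarrow> vbraid set set" where
  "A_set n i = {sigma_pair n i j | j. j \<in> {1..n} \<and> j \<noteq> i}"

definition PwB :: "nat \<Rightarrow> vbraid set set" where
  "PwB n = generate (wB n) {sigma_pair n i j | i j. i \<in> {1..n} \<and> j \<in> {1..n} \<and> i \<noteq> j}"


section \<open>Properties of homomorphisms\<close>

definition abelian_on :: "'a set \<Rightarrow> ('g, 'm) monoid_scheme \<Rightarrow> ('a \<Rightarrow> 'g) \<Rightarrow> bool" where
  "abelian_on H G f \<longleftrightarrow> comm_group (G\<lparr>carrier := f ` H\<rparr>)"

definition cyclic_on :: "'a set \<Rightarrow> ('g, 'm) monoid_scheme \<Rightarrow> ('a \<Rightarrow> 'g) \<Rightarrow> bool" where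
  "cyclic_on H G f \<longleftrightarrow> cyclic_group (G\<lparr>carrier := f ` H\<rparr>)"

definition splits :: "('a \<Rightarrow> 'g) \<Rightarrow> 'a set \<Rightarrow> bool" where
  "splits f S \<longleftrightarrow> card (f ` S) = card S"

definition induced_on_wB ::
  "nat \<Rightarrow> ('g, 'm) monoid_scheme \<Rightarrow> (vbraid \<Rightarrow> 'g) \<Rightarrow> (vbraid set \<Rightarrow> 'g) \<Rightarrow> bool" where
  "induced_on_wB n G \<phi> \<psi> \<longleftrightarrow>
     \<psi> \<in> hom (wB n) G \<and> (\<forall>x \<in> carrier (vB n). \<psi> (wB_proj n x) = \<phi> x)"

definition factors_through_wB ::
  "nat \<Rightarrow> ('g, 'm) monoid_scheme \<Rightarrow> (vbraid \<Rightarrow> 'g) \<Rightarrow> bool" where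
  "factors_through_wB n G \<phi> \<longleftrightarrow> (\<exists>\<psi>. induced_on_wB n G \<phi> \<psi>)"


section \<open>Basic facts\<close>

lemma group_vB: "group (vB n)"
  by (simp add: vB_def group_presented_group)

lemma vB_word_in_carrier: "w \<in> gwords (vB_gens n) \<Longrightarrow> vB_word n w \<in> carrier (vB n)"
  by (simp add: vB_def vB_word_def carrier_presented_group)

lemma vB_rels_gwords:
  "(u, v) \<in> vB_rels n \<Longrightarrow> u \<in> gwords (vB_gens n) \<and> v \<in> gwords (vB_gens n)"
  by (auto simp: vB_rels_def far_def vB_gens_def)

lemma (in group) normal_normal_closure:
  assumes "S \<subseteq> carrier G"
  shows "normal_closure G S \<lhd> G"
  unfolding normal_closure_def
proof (rule normal_generateI)
  show "{g \<otimes> s \<otimes> inv g |g s. g \<in> carrier G \<and> s \<in> S} \<subseteq> carrier G"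
    using assms by auto
next
  fix h k
  assume h: "h \<in> {g \<otimes> s \<otimes> inv g |g s. g \<in> carrier G \<and> s \<in> S}" and k: "k \<in> carrier G"
  then obtain g s where gs: "h = g \<otimes> s \<otimes> inv g" "g \<in> carrier G" "s \<in> S" by auto
  have s: "s \<in> carrier G" using assms gs by auto
  have "k \<otimes> h \<otimes> inv k = (k \<otimes> g) \<otimes> s \<otimes> inv (k \<otimes> g)"
    using gs s k by (simp add: inv_mult_group m_assoc)
  then show "k \<otimes> h \<otimes> inv k \<in> {g \<otimes> s \<otimes> inv g |g s. g \<in> carrier G \<and> s \<in> S}"
    using gs k by blast
qed

lemma welded_kernel_normal: "welded_kernel n \<lhd> vB n"
  unfolding welded_kernel_def
proof (rule group.normal_normal_closure[OF group_vB])
  interpret group "vB n" by (rule group_vB)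
  show "welded_relators n \<subseteq> carrier (vB n)"
    unfolding welded_relators_def
    by (auto intro!: m_closed inv_closed vB_word_in_carrier simp: vB_gens_def)
qed

lemma group_wB: "group (wB n)"
  unfolding wB_def by (rule normal.factorgroup_is_group[OF welded_kernel_normal])

lemma wB_proj_hom: "wB_proj n \<in> hom (vB n) (wB n)"
  unfolding wB_def wB_proj_def using normal.r_coset_hom_Mod[OF welded_kernel_normal] by simp

lemma wB_proj_surj: "wB_proj n ` carrier (vB n) = carrier (wB n)"
  by (simp add: wB_def wB_proj_def carrier_FactGroup)

end

theory Submission
  imports Defs "HOL-Combinatorics.Permutations"
begin

text \<open>If all \<open>\<phi>(\<tau>\<^sub>i)\<close> coincide, the mixed relations make all \<open>\<phi>(\<sigma>\<^sub>i)\<close> coincide and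
  \<open>\<phi>\<close> is abelian. Otherwise the images of the \<open>n(n - 1)/2\<close> transpositions are distinct,
  and conjugating them realises every permutation of the labels, so the image has at least \<open>n!\<close>
  elements, which exceeds the bound of case 3.

  If \<open>\<phi>\<close> factors through the welded braid group, each \<open>A\<^sub>i\<close> consists of commuting elements
  permuted by conjugation. Commuting distinct elements \<open>x\<^sub>1, \<dots>, x\<^sub>m\<close> on which conjugation
  induces all of \<open>S\<^sub>m\<close> force a subgroup of order at least \<open>2\<^bsup>m-1\<^esup> m!\<close>. Apply this with \<open>m = n - 1\<close>
  if some \<open>A\<^sub>i\<close> is split. If none is, each \<open>A\<^sub>i\<close> is sent to one element \<open>a\<^sub>i\<close>; the \<open>a\<^sub>i\<close>
  commute since \<open>\<sigma>\<^bsub>1,2\<^esub>\<close> and \<open>\<sigma>\<^bsub>3,4\<^esub>\<close> do, so they are either distinct (\<open>m = n\<close>) or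
  all equal, and in the latter case the restriction to the pure group is cyclic.
  Case 2(c) is therefore never needed.\<close>

section \<open>Permutations of an interval and Coxeter actions\<close>

text \<open>Every permutation of a finite set is a product of transpositions, and every
  transposition of an interval is a product of adjacent ones.\<close>

lemma permutes_adjacent_induct [consumes 1, case_names id step]:
  assumes "p permutes {1..n}" and id: "P id"
    and step: "\<And>k p. k \<in> {1..<n} \<Longrightarrow> p permutes {1..n} \<Longrightarrow> P p
      \<Longrightarrow> P (transpose k (Suc k) \<circ> p)"
  shows "P p"
proof -
  have swap: "P (transpose a b \<circ> p)"
    if "1 \<le> a" "a < b" "b \<le> n" "p permutes {1..n}" "P p" for a b p
  proof -
    have "Suc a \<le> b" using that by simp
    then show ?thesis using that
    proof (induction b arbitrary: p rule: dec_induct)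
      case base
      then show ?case using assms(3)[of a p] by (simp add: comp_def)
    next
      case (step b)
      let ?t = "transpose b (Suc b)"
      have t: "?t permutes {1..n}" "transpose a b permutes {1..n}"
        using step by (auto intro!: permutes_swap_id)
      have "P (?t \<circ> p)" using assms(3)[of b p] step.hyps step.prems by (simp add: comp_def)
      then have "P (transpose a b \<circ> (?t \<circ> p))"
        using step.hyps step.prems t by (intro step.IH permutes_compose) (auto simp: comp_def)
      then have "P (?t \<circ> (transpose a b \<circ> (?t \<circ> p)))"
        using assms(3)[of b "transpose a b \<circ> (?t \<circ> p)"] step.hyps step.prems t
        by (simp add: permutes_compose)
      \<comment> \<open>Conjugating the swap of a and b by the swap of b and b + 1 moves its upper
        end to b + 1.\<close>
      moreover have "?t \<circ> (transpose a b \<circ> (?t \<circ> p)) = transpose a (Suc b) \<circ> p"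
        using step by (auto simp: fun_eq_iff transpose_def)
      ultimately show ?case by (simp add: comp_def)
    qed
  qed
  show ?thesis using assms(1) _ id
  proof (rule permutes_induct)
    fix a b p assume "a \<in> {1..n}" "b \<in> {1..n}" "P p" "p permutes {1..n}"
    then show "P (transpose a b \<circ> p)"
      using swap[of a b p] swap[of b a p] by (cases a b rule: linorder_cases) (auto simp: transpose_commute)
  qed simp
qed

text \<open>\<open>T\<close> and its image have complements of equal size in \<open>S\<close>, so
  any bijection between these completes \<open>f\<close>.\<close>

lemma permutes_extends_inj_on:
  assumes "finite S" "T \<subseteq> S" "f ` T \<subseteq> S" "inj_on f T"
  obtains p where "p permutes S" "\<And>x. x \<in> T \<Longrightarrow> p x = f x"
proof -
  have fin: "finite T" using assms finite_subset by blast
  have "card (S - T) = card (S - f ` T)"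
    using assms fin by (simp add: card_Diff_subset card_image)
  then obtain h where h: "bij_betw h (S - T) (S - f ` T)"
    using assms finite_same_card_bij[of "S - T" "S - f ` T"] by auto
  define p where "p x = (if x \<in> T then f x else if x \<in> S then h x else x)" for x
  have "bij_betw p T (f ` T)"
    using assms by (auto simp: p_def bij_betw_def inj_on_def)
  moreover have "bij_betw p (S - T) (S - f ` T)"
    using h bij_betw_cong[of "S - T" p h] by (simp add: p_def)
  ultimately have "bij_betw p (T \<union> (S - T)) (f ` T \<union> (S - f ` T))"
    by (rule bij_betw_combine) auto
  moreover have "T \<union> (S - T) = S" "f ` T \<union> (S - f ` T) = S" using assms by auto
  ultimately have "bij_betw p S S" by simp
  then have "p permutes S"
    using assms by (intro bij_imp_permutes) (auto simp: p_def)
  then show ?thesis using that by (simp add: p_def)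
qed

section \<open>Families labelled by ordered pairs under a Coxeter action\<close>

text \<open>These are the Coxeter relations of the adjacent transpositions in S_n. They are required
  on \<open>C\<close> alone, since conjugation obeys group laws only inside the carrier.\<close>

locale coxeter_action =
  fixes n :: nat and C :: "'a set" and c :: "nat \<Rightarrow> 'a \<Rightarrow> 'a"
  assumes closed: "k \<in> {1..<n} \<Longrightarrow> y \<in> C \<Longrightarrow> c k y \<in> C"
    and invol: "k \<in> {1..<n} \<Longrightarrow> y \<in> C \<Longrightarrow> c k (c k y) = y"
    and far_commute: "k \<in> {1..<n} \<Longrightarrow> l \<in> {1..<n} \<Longrightarrow> Suc k < l \<Longrightarrow> y \<in> C
      \<Longrightarrow> c k (c l y) = c l (c k y)"
    and braid: "1 \<le> k \<Longrightarrow> Suc k < n \<Longrightarrow> y \<in> C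
      \<Longrightarrow> c k (c (Suc k) (c k y)) = c (Suc k) (c k (c (Suc k) y))"
begin

text \<open>In an admissible family \<open>x i\<close> carries the label \<open>(i, i + 1)\<close>. The action of \<open>S\<^sub>n\<close>
  generated by the involutions \<open>c k\<close> extends it to all ordered pairs of distinct labels:
  \<open>flip x i\<close> carries \<open>(i + 1, i)\<close> and \<open>up x i m\<close> carries \<open>(i, m + 1)\<close>.\<close>

definition admissible :: "(nat \<Rightarrow> 'a) \<Rightarrow> bool" where
  "admissible x \<longleftrightarrow> (\<forall>i\<in>{1..<n}. x i \<in> C)
    \<and> (\<forall>i\<in>{1..<n}. \<forall>k\<in>{1..<n}. Suc i < k \<or> Suc k < i \<longrightarrow> c k (x i) = x i)
    \<and> (\<forall>i. 1 \<le> i \<and> Suc i < n \<longrightarrow> c (Suc i) (x i) = c i (x (Suc i)))"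

definition up :: "(nat \<Rightarrow> 'a) \<Rightarrow> nat \<Rightarrow> nat \<Rightarrow> 'a" where
  "up x i m = foldr c [i..<m] (x m)"

definition flip :: "(nat \<Rightarrow> 'a) \<Rightarrow> nat \<Rightarrow> 'a" where
  "flip x k = c k (x k)"

text \<open>A descending label is treated as an ascending one for the family \<open>flip x\<close>,
  so that facts about \<open>up\<close> serve both orders.\<close>

definition pair :: "(nat \<Rightarrow> 'a) \<Rightarrow> nat \<Rightarrow> nat \<Rightarrow> 'a" where
  "pair x i j = (if i < j then up x i (j - 1) else up (flip x) j (i - 1))"

lemma far_commute':
  "k \<in> {1..<n} \<Longrightarrow> l \<in> {1..<n} \<Longrightarrow> Suc k < l \<or> Suc l < k \<Longrightarrow> y \<in> C
    \<Longrightarrow> c k (c l y) = c l (c k y)"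
  using far_commute by metis

lemma admissibleD:
  assumes "admissible x"
  shows "i \<in> {1..<n} \<Longrightarrow> x i \<in> C"
    and "i \<in> {1..<n} \<Longrightarrow> k \<in> {1..<n} \<Longrightarrow> Suc i < k \<or> Suc k < i \<Longrightarrow> c k (x i) = x i"
    and "1 \<le> i \<Longrightarrow> Suc i < n \<Longrightarrow> c (Suc i) (x i) = c i (x (Suc i))"
  using assms by (auto simp: admissible_def)

lemma admissible_flip:
  assumes "admissible x"
  shows "admissible (flip x)"
proof -
  note D = admissibleD[OF assms]
  have "c k (flip x i) = flip x i"
    if "i \<in> {1..<n}" "k \<in> {1..<n}" "Suc i < k \<or> Suc k < i" for i k
    using that D far_commute'[of k i "x i"] by (auto simp: flip_def)
  moreover have "c (Suc i) (flip x i) = c i (flip x (Suc i))" if i: "1 \<le> i" "Suc i < n" for i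
  proof -
    have C: "x i \<in> C" "x (Suc i) \<in> C" using D i by auto
    \<comment> \<open>Solving the admissibility equation for \<open>x (Suc i)\<close> expresses
      everything through \<open>x i\<close>, where the braid relation applies.\<close>
    have x: "x (Suc i) = c i (c (Suc i) (x i))"
      using D(3)[of i] invol[of i "x (Suc i)"] C i by simp
    have "c i (c (Suc i) (x (Suc i))) = c i (c i (c (Suc i) (c i (x i))))"
      using x braid[of i "x i"] C i by simp
    also have "\<dots> = c (Suc i) (c i (x i))"
      using i C by (intro invol closed) auto
    finally show ?thesis by (simp add: flip_def)
  qed
  ultimately show ?thesis
    using D(1) closed by (auto simp: admissible_def flip_def)
qed

lemma flip_flip: "admissible x \<Longrightarrow> k \<in> {1..<n} \<Longrightarrow> c k (flip x k) = x k"
  using admissibleD invol by (simp add: flip_def)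


lemma up_base: "up x i i = x i"
  by (simp add: up_def)

lemma up_step: "i < m \<Longrightarrow> up x i m = c i (up x (Suc i) m)"
  by (simp add: up_def upt_conv_Cons)

context
  fixes x assumes x: "admissible x"
begin

lemma up_closed: "i \<le> m \<Longrightarrow> 1 \<le> i \<Longrightarrow> m < n \<Longrightarrow> up x i m \<in> C"
proof (induction i rule: inc_induct)
  case base
  then show ?case using admissibleD(1)[OF x, of m] by (simp add: up_base)
next
  case (step i)
  then show ?case using closed[of i] by (simp add: up_step)
qed

lemma up_far:
  "i \<le> m \<Longrightarrow> 1 \<le> i \<Longrightarrow> m < n \<Longrightarrow> k \<in> {1..<n} \<Longrightarrow> Suc k < i \<or> Suc m < k
    \<Longrightarrow> c k (up x i m) = up x i m"
proof (induction i rule: inc_induct)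
  case base
  then show ?case using admissibleD(2)[OF x, of m k] by (auto simp: up_base)
next
  case (step i)
  have "c k (c i (up x (Suc i) m)) = c i (c k (up x (Suc i) m))"
    using step.hyps step.prems by (intro far_commute' up_closed) auto
  then show ?case using step by (auto simp: up_step)
qed

lemma up_right:
  "i \<le> m \<Longrightarrow> 1 \<le> i \<Longrightarrow> Suc m < n \<Longrightarrow> c (Suc m) (up x i m) = up x i (Suc m)"
proof (induction i rule: inc_induct)
  case base
  then show ?case using admissibleD(3)[OF x, of m] by (simp add: up_base up_step)
next
  case (step i)
  have "c (Suc m) (c i (up x (Suc i) m)) = c i (c (Suc m) (up x (Suc i) m))"
    using step.hyps step.prems by (intro far_commute' up_closed) auto
  then show ?case using step by (auto simp: up_step)
qed

text \<open>The swap of k and k + 1 moves neither of the labels i and m + 1.\<close>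

lemma up_middle:
  assumes "1 \<le> i" "i < k" "k < m" "m < n"
  shows "c k (up x i m) = up x i m"
proof -
  have "i \<le> k - 1" using assms by simp
  then show ?thesis using assms
  proof (induction i rule: inc_induct)
    case base
    then obtain l where l: "k = Suc l" "1 \<le> l" by (cases k) auto
    have C: "up x (Suc k) m \<in> C" using assms by (intro up_closed) auto
    have "up x l m = c l (c (Suc l) (up x (Suc k) m))"
      using l assms by (simp add: up_step)
    \<comment> \<open>The braid relation brings \<open>c l\<close> to the innermost place, where it
      meets labels that are all too large for it to move.\<close>
    then have "c k (up x l m) = c l (c (Suc l) (c l (up x (Suc k) m)))"
      using l assms C braid[of l] by simp
    also have "c l (up x (Suc k) m) = up x (Suc k) m"
      using l assms by (intro up_far) auto
    finally show ?case using l assms by (simp add: up_step)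
  next
    case (step i)
    have "c k (c i (up x (Suc i) m)) = c i (c k (up x (Suc i) m))"
      using step.hyps step.prems assms by (intro far_commute' up_closed) auto
    then show ?case using step by (auto simp: up_step)
  qed
qed

text \<open>The second label of \<open>up x i m\<close> is m + 1, whence the \<open>Suc m\<close>
  and the final \<open>- 1\<close>. The excluded case exchanges the two labels and leads to
  \<open>flip x\<close>.\<close>

lemma up_transpose:
  assumes "1 \<le> i" "i \<le> m" "m < n" "k \<in> {1..<n}" "\<not> (i = k \<and> m = k)"
  shows "c k (up x i m) = up x (transpose k (Suc k) i) (transpose k (Suc k) (Suc m) - 1)"
proof -
  consider "Suc k < i" | "Suc k = i" | "i = k" "k < m" | "i < k" "k < m" | "i < k" "k = m"
    | "k = Suc m" | "Suc m < k" using assms by linarith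
  then show ?thesis
  proof cases
    case 1
    then show ?thesis using assms up_far by (simp add: transpose_def)
  next
    case 2
    then have "up x k m = c k (up x i m)" using assms by (simp add: up_step)
    then show ?thesis using 2 assms by (simp add: transpose_def)
  next
    case 3
    have "c k (up x k m) = c k (c k (up x (Suc k) m))" using 3 by (simp add: up_step)
    also have "\<dots> = up x (Suc k) m"
      using 3 assms by (intro invol up_closed) auto
    finally show ?thesis using 3 assms by (simp add: transpose_def)
  next
    case 4
    then show ?thesis using assms up_middle by (simp add: transpose_def)
  next
    case 5
    then obtain l where l: "k = Suc l" "i \<le> l" by (cases k) auto
    have "c k (up x i m) = c k (c k (up x i l))" using 5 l assms up_right[of i l] by simp
    also have "\<dots> = up x i l"
      using 5 l assms by (intro invol up_closed) auto
    finally show ?thesis using 5 l by (auto simp: transpose_def)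
  next
    case 6
    then show ?thesis using assms up_right[of i m] by (simp add: transpose_def)
  next
    case 7
    then show ?thesis using assms up_far by (simp add: transpose_def)
  qed
qed

end

lemma pair_closed:
  assumes "admissible x" "i \<in> {1..n}" "j \<in> {1..n}" "i \<noteq> j"
  shows "pair x i j \<in> C"
  using assms up_closed[of x i "j - 1"] up_closed[of "flip x" j "i - 1"] admissible_flip
  by (auto simp: pair_def)

lemma pair_transpose:
  assumes x: "admissible x" and ij: "i \<in> {1..n}" "j \<in> {1..n}" "i \<noteq> j" and k: "k \<in> {1..<n}"
  shows "c k (pair x i j) = pair x (transpose k (Suc k) i) (transpose k (Suc k) j)"
proof (cases "{i, j} = {k, Suc k}")
  case True
  then have "i = k \<and> j = Suc k \<or> i = Suc k \<and> j = k" by (auto simp: doubleton_eq_iff)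
  then show ?thesis
    using flip_flip[OF x k] by (auto simp: pair_def up_base transpose_def) (auto simp: flip_def)
next
  case False
  \<comment> \<open>An adjacent swap that does not exchange i and j preserves their order, so both
    sides use the same branch of \<open>pair\<close>.\<close>
  then have less: "transpose k (Suc k) i < transpose k (Suc k) j \<longleftrightarrow> i < j"
    using ij by (auto simp: transpose_def)
  show ?thesis
  proof (cases "i < j")
    case True
    then have "\<not> (i = k \<and> j - 1 = k)" using False by auto
    then show ?thesis
      using up_transpose[OF x, of i "j - 1" k] True less ij k by (simp add: pair_def)
  next
    case ji: False
    then have "\<not> (j = k \<and> i - 1 = k)" using False ij by auto
    then show ?thesis
      using up_transpose[OF admissible_flip[OF x], of j "i - 1" k] ji less ij k
      by (simp add: pair_def)
  qed
qed

text \<open>For j < i, \<open>up\<close> starts at the index i - 1 and lowers the smaller label,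
  whereas the word for \<sigma>_{i,j} starts at j and raises the larger one. Repeated use of
  \<open>up_right\<close> reconciles the two.\<close>

lemma pair_greater_conv:
  assumes x: "admissible x" and "1 \<le> j" "j < i" "i \<le> n"
  shows "pair x i j = foldr c (rev [Suc j..<i]) (flip x j)"
proof -
  have "Suc j \<le> i" using assms by simp
  then show ?thesis using assms(2-)
  proof (induction i rule: dec_induct)
    case base
    then show ?case by (simp add: pair_def up_base)
  next
    case (step i)
    then obtain m where m: "i = Suc m" by (cases i) auto
    have "pair x (Suc i) j = c i (pair x i j)"
      using step m up_right[OF admissible_flip[OF x], of j m] by (simp add: pair_def)
    then show ?case using step by simp
  qed
qed

end

section \<open>Totally symmetric families in finite groups\<close>

context group
begin

lemma commute_generate:
  assumes E: "E \<subseteq> carrier G" and g: "g \<in> carrier G"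
    and comm: "\<And>e. e \<in> E \<Longrightarrow> g \<otimes> e = e \<otimes> g"
    and y: "y \<in> generate G E"
  shows "g \<otimes> y = y \<otimes> g"
  using y
proof (induction rule: generate.induct)
  case (inv h)
  then have h: "h \<in> carrier G" using E by blast
  have "g = h \<otimes> g \<otimes> inv h" using comm[OF inv] g h by (metis inv_solve_right' m_closed)
  then have "inv h \<otimes> g = g \<otimes> inv h"
    using g h by (metis inv_closed inv_solve_left m_assoc m_closed)
  then show ?case by simp
next
  case (eng a b)
  then have "a \<in> carrier G" "b \<in> carrier G" using generate_in_carrier[OF E] by auto
  then show ?case using eng g by (metis m_assoc)
qed (use g comm in auto)

text \<open>The coset of \<open>K\<close> through \<open>y\<close> lies in \<open>L\<close> and is
  disjoint from \<open>K\<close>.\<close>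

lemma card_proper_supergroup:
  assumes K: "subgroup K G" and L: "subgroup L G" "finite L" and "K \<subseteq> L" "y \<in> L" "y \<notin> K"
  shows "2 * card K \<le> card L"
proof -
  let ?yK = "(\<lambda>k. y \<otimes> k) ` K"
  have y: "y \<in> carrier G" using L assms subgroup.mem_carrier by fast
  have "inj_on (\<lambda>k. y \<otimes> k) K"
    using y K by (auto simp: inj_on_def subgroup.mem_carrier)
  then have "card ?yK = card K" by (rule card_image)
  moreover have "K \<inter> ?yK = {}"
  proof -
    have "y \<in> K" if "k \<in> K" "y \<otimes> k \<in> K" for k
    proof -
      have "y \<otimes> k \<otimes> inv k \<in> K"
        by (rule subgroup.m_closed[OF K that(2) subgroup.m_inv_closed[OF K that(1)]])
      then show ?thesis
        using y subgroup.mem_carrier[OF K that(1)] by (simp add: m_assoc)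
    qed
    then show ?thesis using assms by auto
  qed
  moreover have "?yK \<subseteq> L"
    using assms by (auto intro: subgroup.m_closed)
  moreover have "finite K" using L assms finite_subset by blast
  ultimately show ?thesis
    using card_mono[of L "K \<union> ?yK"] assms by (simp add: card_Un_disjoint)
qed

text \<open>The power of two bounds the commutative subgroup \<open>K\<close> generated by the
  family, which grows properly with each new element up to the last. The factorial counts the ways
  in which \<open>H\<close> permutes the family by conjugation.\<close>

lemma card_ge_totally_symmetric:
  fixes x :: "'i \<Rightarrow> 'a"
  assumes H: "subgroup H G" "finite H" and S: "finite S" "p \<in> S"
    and x: "x ` S \<subseteq> H" "inj_on x S"
    and comm: "\<And>i j. i \<in> S \<Longrightarrow> j \<in> S \<Longrightarrow> x i \<otimes> x j = x j \<otimes> x i"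
    and conj: "\<And>q. q permutes S \<Longrightarrow> \<exists>g\<in>H. \<forall>i\<in>S. g \<otimes> x i = x (q i) \<otimes> g"
  shows "2 ^ (card S - 1) * fact (card S) \<le> card H"
proof -
  have HG: "H \<subseteq> carrier G" using H subgroup.subset by blast
  have xG: "x i \<in> carrier G" if "i \<in> S" for i using x HG that by blast
  \<comment> \<open>The index p is held back: it is the place to which a new element is moved in
    order to prove it new.\<close>
  have pow: "2 ^ card T \<le> card (generate G (x ` T))" if "finite T" "T \<subseteq> S - {p}" for T
    using that
  proof (induction T)
    case empty
    then show ?case by (simp add: generate_empty)
  next
    case (insert r T)
    have sub: "x ` T \<subseteq> carrier G" "x ` insert r T \<subseteq> carrier G" using insert xG by auto
    have "x r \<notin> generate G (x ` T)"
    proof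
      assume r: "x r \<in> generate G (x ` T)"
      have "transpose r p permutes S" using insert S by (intro permutes_swap_id) auto
      then obtain g where g: "g \<in> H" "\<forall>i\<in>S. g \<otimes> x i = x (transpose r p i) \<otimes> g"
        using conj by blast
      have gG: "g \<in> carrier G" using g HG by auto
      have "g \<otimes> x i = x i \<otimes> g" if "i \<in> T" for i
      proof -
        have "transpose r p i = i" using that insert by (auto simp: transpose_def)
        then show ?thesis using that g insert by (metis Diff_subset insert_subset subsetD)
      qed
      then have "g \<otimes> x r = x r \<otimes> g"
        using commute_generate[OF sub(1) gG _ r] by blast
      moreover have "g \<otimes> x r = x p \<otimes> g" using g insert by auto
      ultimately have "x r = x p" using gG xG insert S by auto
      then show False using x insert S by (auto simp: inj_on_def)
    qed
    moreover have "generate G (x ` insert r T) \<subseteq> H"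
      using insert x H by (intro generate_subgroup_incl) auto
    ultimately have "2 * card (generate G (x ` T)) \<le> card (generate G (x ` insert r T))"
      using sub H finite_subset
      by (intro card_proper_supergroup[where y = "x r"] generate_is_subgroup mono_generate)
        (auto intro: generate.incl)
    then show ?case using insert by auto
  qed
  let ?K = "generate G (x ` S)"
  have KH: "?K \<subseteq> H" using x H by (intro generate_subgroup_incl)
  have "generate G (x ` (S - {p})) \<subseteq> ?K" by (intro mono_generate) auto
  then have "card (generate G (x ` (S - {p}))) \<le> card ?K"
    using KH H finite_subset by (intro card_mono) auto
  then have "2 ^ (card S - 1) \<le> card ?K"
    using pow[of "S - {p}"] S by simp
  moreover have "card ?K * fact (card S) \<le> card H"
  proof -
    obtain g where g: "\<And>q. q permutes S \<Longrightarrow> g q \<in> H"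
        "\<And>q i. q permutes S \<Longrightarrow> i \<in> S \<Longrightarrow> g q \<otimes> x i = x (q i) \<otimes> g q"
      using conj by metis
    let ?f = "\<lambda>(k, q). k \<otimes> g q"
    \<comment> \<open>Elements of \<open>K\<close> centralise the family, so the product induces the
      same permutation as \<open>g q\<close>. Hence the product determines q, and then k.\<close>
    have act: "k \<otimes> g q \<otimes> x i = x (q i) \<otimes> (k \<otimes> g q)"
      if k: "k \<in> ?K" and q: "q permutes S" and i: "i \<in> S" for k q i
    proof -
      have G: "k \<in> carrier G" "g q \<in> carrier G" "q i \<in> S"
        using k KH HG g q i permutes_in_image[OF q, of i] by auto
      have "x (q i) \<otimes> k = k \<otimes> x (q i)"
        using commute_generate[of "x ` S" "x (q i)" k] xG G comm k by auto
      then show ?thesis using G g q i xG by (metis m_assoc)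
    qed
    have "inj_on ?f (?K \<times> {q. q permutes S})"
    proof (rule inj_onI, clarify)
      fix k q k' q'
      assume k: "k \<in> ?K" "k' \<in> ?K" and q: "q permutes S" "q' permutes S"
        and eq: "k \<otimes> g q = k' \<otimes> g q'"
      have G: "k \<in> carrier G" "k' \<in> carrier G" "g q \<in> carrier G" "g q' \<in> carrier G"
        using k KH HG g q by auto
      have "q i = q' i" if i: "i \<in> S" for i
      proof -
        have qi: "q i \<in> S" "q' i \<in> S" using i q permutes_in_image by metis+
        have "x (q i) \<otimes> (k \<otimes> g q) = x (q' i) \<otimes> (k \<otimes> g q)"
          using act k q i eq by metis
        then have "x (q i) = x (q' i)" using G xG qi by auto
        then show ?thesis using x qi by (auto simp: inj_on_def)
      qed
      then have "q = q'" using q by (metis permutes_not_in ext)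
      then show "k = k' \<and> q = q'" using eq G by auto
    qed
    moreover have "?f ` (?K \<times> {q. q permutes S}) \<subseteq> H"
      using KH g H by (auto intro: subgroup.m_closed)
    ultimately have "card (?K \<times> {q. q permutes S}) \<le> card H"
      using H card_inj_on_le by blast
    then show ?thesis
      using S by (simp add: card_cartesian_product card_permutations)
  qed
  ultimately show ?thesis by (meson le_trans mult_le_mono1)
qed

end

section \<open>Relabelling by conjugation in a finite subgroup\<close>

text \<open>Conjugation is written as \<open>t k \<otimes> s i j = s i' j' \<otimes> t k\<close>,
  which avoids inverses and composes by associativity.\<close>

locale symmetric_pairs = group G for G (structure) +
  fixes n :: nat and H :: "'a set" and t :: "nat \<Rightarrow> 'a" and s :: "nat \<Rightarrow> nat \<Rightarrow> 'a"
  assumes subgroup_H: "subgroup H G" and finite_H: "finite H"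
    and t_in: "k \<in> {1..<n} \<Longrightarrow> t k \<in> H"
    and s_in: "i \<in> {1..n} \<Longrightarrow> j \<in> {1..n} \<Longrightarrow> i \<noteq> j \<Longrightarrow> s i j \<in> H"
    and t_s: "k \<in> {1..<n} \<Longrightarrow> i \<in> {1..n} \<Longrightarrow> j \<in> {1..n} \<Longrightarrow> i \<noteq> j
      \<Longrightarrow> t k \<otimes> s i j = s (transpose k (Suc k) i) (transpose k (Suc k) j) \<otimes> t k"
begin

lemma H_carrier: "h \<in> H \<Longrightarrow> h \<in> carrier G"
  using subgroup_H subgroup.mem_carrier by metis

lemma conj_permutes:
  assumes "p permutes {1..n}"
  shows "\<exists>g\<in>H. \<forall>i\<in>{1..n}. \<forall>j\<in>{1..n}. i \<noteq> j \<longrightarrow> g \<otimes> s i j = s (p i) (p j) \<otimes> g"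
  using assms
proof (induction rule: permutes_adjacent_induct)
  case id
  show ?case
    using subgroup_H s_in H_carrier by (intro bexI[of _ \<one>]) (auto intro: subgroup.one_closed)
next
  case (step k p)
  then obtain g where g: "g \<in> H"
    "\<And>i j. i \<in> {1..n} \<Longrightarrow> j \<in> {1..n} \<Longrightarrow> i \<noteq> j \<Longrightarrow> g \<otimes> s i j = s (p i) (p j) \<otimes> g"
    by auto
  have "t k \<otimes> g \<otimes> s i j = s ((transpose k (Suc k) \<circ> p) i) ((transpose k (Suc k) \<circ> p) j) \<otimes> (t k \<otimes> g)"
    if ij: "i \<in> {1..n}" "j \<in> {1..n}" "i \<noteq> j" for i j
  proof -
    let ?c = "transpose k (Suc k)"
    have p: "p i \<in> {1..n}" "p j \<in> {1..n}" "p i \<noteq> p j"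
      using step ij permutes_in_image permutes_inj inj_eq by metis+
    have c: "?c (p i) \<in> {1..n}" "?c (p j) \<in> {1..n}" "?c (p i) \<noteq> ?c (p j)"
      using p step by (auto simp: transpose_def)
    note G = H_carrier[OF t_in[OF step(1)]] H_carrier[OF g(1)] H_carrier[OF s_in[OF p]]
      H_carrier[OF s_in[OF ij]] H_carrier[OF s_in[OF c]]
    have "t k \<otimes> g \<otimes> s i j = t k \<otimes> s (p i) (p j) \<otimes> g" using G g ij by (simp add: m_assoc)
    then show ?thesis using G t_s[OF step(1) p] by (simp add: m_assoc)
  qed
  then show ?case
    using g step t_in subgroup_H by (intro bexI[of _ "t k \<otimes> g"]) (auto intro: subgroup.m_closed)
qed

text \<open>Conjugation by an element realising p carries one equation to the other. Thus an
  equation for one choice of labels holds for all choices with the same pattern of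
  coincidences.\<close>

lemma transfer_eq:
  assumes "p permutes {1..n}" "s i j = s k l"
    and ijkl: "{i, j, k, l} \<subseteq> {1..n}" "i \<noteq> j" "k \<noteq> l"
  shows "s (p i) (p j) = s (p k) (p l)"
proof -
  obtain g where g: "g \<in> H"
    "\<And>i j. i \<in> {1..n} \<Longrightarrow> j \<in> {1..n} \<Longrightarrow> i \<noteq> j \<Longrightarrow> g \<otimes> s i j = s (p i) (p j) \<otimes> g"
    using conj_permutes[OF assms(1)] by auto
  have p: "p i \<in> {1..n}" "p j \<in> {1..n}" "p k \<in> {1..n}" "p l \<in> {1..n}" "p i \<noteq> p j" "p k \<noteq> p l"
    using assms permutes_in_image[OF assms(1)] permutes_inj[OF assms(1)]
    by (auto simp: inj_eq simp del: atLeastAtMost_iff)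
  have "s (p i) (p j) \<otimes> g = s (p k) (p l) \<otimes> g" using g assms by (metis insert_subset)
  then show ?thesis using g p s_in H_carrier by auto
qed

lemma transfer_commute:
  assumes "p permutes {1..n}" "s i j \<otimes> s k l = s k l \<otimes> s i j"
    and ijkl: "{i, j, k, l} \<subseteq> {1..n}" "i \<noteq> j" "k \<noteq> l"
  shows "s (p i) (p j) \<otimes> s (p k) (p l) = s (p k) (p l) \<otimes> s (p i) (p j)"
proof -
  obtain g where g: "g \<in> H"
    "\<And>i j. i \<in> {1..n} \<Longrightarrow> j \<in> {1..n} \<Longrightarrow> i \<noteq> j \<Longrightarrow> g \<otimes> s i j = s (p i) (p j) \<otimes> g"
    using conj_permutes[OF assms(1)] by auto
  have p: "p i \<in> {1..n}" "p j \<in> {1..n}" "p k \<in> {1..n}" "p l \<in> {1..n}" "p i \<noteq> p j" "p k \<noteq> p l"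
    using assms permutes_in_image[OF assms(1)] permutes_inj[OF assms(1)]
    by (auto simp: inj_eq simp del: atLeastAtMost_iff)
  let ?a = "s i j" and ?b = "s k l" and ?a' = "s (p i) (p j)" and ?b' = "s (p k) (p l)"
  have G: "g \<in> carrier G" "?a \<in> carrier G" "?b \<in> carrier G" "?a' \<in> carrier G" "?b' \<in> carrier G"
    using g p s_in H_carrier ijkl by auto
  have a: "g \<otimes> ?a = ?a' \<otimes> g" and b: "g \<otimes> ?b = ?b' \<otimes> g" using g ijkl by auto
  have "?a' \<otimes> ?b' \<otimes> g = ?a' \<otimes> (g \<otimes> ?b)" using G b by (simp add: m_assoc)
  also have "\<dots> = g \<otimes> (?a \<otimes> ?b)" using G a by (metis m_assoc)
  also have "\<dots> = g \<otimes> (?b \<otimes> ?a)" using assms by simp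
  also have "\<dots> = ?b' \<otimes> (g \<otimes> ?a)" using G b by (metis m_assoc)
  also have "\<dots> = ?b' \<otimes> ?a' \<otimes> g" using G a by (simp add: m_assoc)
  finally show ?thesis using G by auto
qed

lemma obtain_fresh:
  assumes "finite T" "card T < n"
  obtains e where "e \<in> {1..n}" "e \<notin> T"
proof -
  have "\<not> {1..n} \<subseteq> T" using card_mono[OF assms(1), of "{1..n}"] assms by auto
  then show ?thesis using that by blast
qed

text \<open>Lists record which label goes where, so a pattern such as 1, 2, 3 can be sent to any
  three distinct labels.\<close>

lemma obtain_permutes:
  assumes "distinct xs" "distinct ys" "length xs = length ys" "set xs \<subseteq> {1..n}" "set ys \<subseteq> {1..n}"
  obtains p where "p permutes {1..n}" "map p xs = ys"
proof -
  let ?f = "\<lambda>x. the (map_of (zip xs ys) x)"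
  have f: "?f (xs ! i) = ys ! i" if "i < length xs" for i
    using assms that by (simp add: map_of_zip_nth)
  then have m: "map ?f xs = ys" using assms by (intro nth_equalityI) auto
  then have "?f ` set xs = set ys" by (metis set_map)
  moreover from m have "inj_on ?f (set xs)" using assms by (metis distinct_map)
  ultimately obtain p where "p permutes {1..n}" "\<And>x. x \<in> set xs \<Longrightarrow> p x = ?f x"
    using permutes_extends_inj_on[of "{1..n}" "set xs" ?f] assms by auto
  then show ?thesis using that m by (metis map_cong)
qed

text \<open>A single inequality between overlapping pairs spreads by relabelling, making
  \<open>s\<close> injective on unordered pairs. A permutation is then determined by its action on
  these pairs, so the chosen conjugators are distinct.\<close>

lemma card_ge_fact:
  assumes sym: "\<And>i j. i \<in> {1..n} \<Longrightarrow> j \<in> {1..n} \<Longrightarrow> i \<noteq> j \<Longrightarrow> s i j = s j i"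
    and n: "5 \<le> n" and neq: "k \<in> {1..<n - 1}" "s k (Suc k) \<noteq> s (Suc k) (Suc (Suc k))"
  shows "fact n \<le> card H"
proof -
  have three: False
    if eq: "s a b = s b c" and abc: "{a, b, c} \<subseteq> {1..n}" "a \<noteq> b" "b \<noteq> c" "a \<noteq> c" for a b c
  proof -
    have k: "1 \<le> k" "Suc (Suc k) \<le> n" using neq(1) by auto
    then obtain p where p: "p permutes {1..n}" "map p [a, b, c] = [k, Suc k, Suc (Suc k)]"
      using obtain_permutes[of "[a, b, c]" "[k, Suc k, Suc (Suc k)]"] abc by auto
    have "s (p a) (p b) = s (p b) (p c)" using transfer_eq[OF p(1) eq] abc by simp
    then show False using p(2) abc neq by auto
  qed
  have inj: "{a, b} = {c, d}"
    if eq: "s a b = s c d" and abcd: "{a, b, c, d} \<subseteq> {1..n}" "a \<noteq> b" "c \<noteq> d" for a b c d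
  proof (rule ccontr)
    assume neq: "{a, b} \<noteq> {c, d}"
    show False
    proof (cases "{a, b} \<inter> {c, d} = {}")
      case True
      \<comment> \<open>With five labels there is a spare e. Replacing d by e leaves
        \<open>s a b\<close> unchanged, so the pairs {c, d} and {c, e}, which overlap, have equal
        values.\<close>
      have "card {a, b, c, d} \<le> 4" by (simp add: card_insert_if)
      then obtain e where e: "e \<in> {1..n}" "e \<notin> {a, b, c, d}"
        using obtain_fresh[of "{a, b, c, d}"] n by auto
      have "transpose d e permutes {1..n}" using e abcd by (intro permutes_swap_id) auto
      from transfer_eq[OF this eq] have "s a b = s c e"
        using e abcd True by (auto simp: transpose_def)
      then have "s d c = s c e" using eq sym abcd by auto
      then show False using three[of d c e] e abcd by auto
    next
      case False
      then show ?thesis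
        using three[of a b d] three[of a b c] three[of b a d] three[of b a c] sym eq abcd neq
        by (auto simp: doubleton_eq_iff)
    qed
  qed
  obtain g where g: "\<And>p. p permutes {1..n} \<Longrightarrow> g p \<in> H"
    "\<And>p i j. p permutes {1..n} \<Longrightarrow> i \<in> {1..n} \<Longrightarrow> j \<in> {1..n} \<Longrightarrow> i \<noteq> j
      \<Longrightarrow> g p \<otimes> s i j = s (p i) (p j) \<otimes> g p"
    using conj_permutes by metis
  have "inj_on g {p. p permutes {1..n}}"
  proof (rule inj_onI, clarify)
    fix p q assume p: "p permutes {1..n}" and q: "q permutes {1..n}" and eq: "g p = g q"
    show "p = q"
    proof (rule ccontr)
      assume "p \<noteq> q"
      then obtain i where i: "p i \<noteq> q i" by auto
      then have i1: "i \<in> {1..n}" using permutes_not_in p q by metis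
      obtain m where m: "m \<in> {1..n}" "p m = q i"
        using p q i1 by (metis permutes_in_image permutes_surj surjD)
      \<comment> \<open>Avoiding m as well as i keeps \<open>q i = p m\<close> out of the pair {p i,
        p j}.\<close>
      have "card {i, m} \<le> 2" by (simp add: card_insert_if)
      then obtain j where j: "j \<in> {1..n}" "j \<noteq> i" "j \<noteq> m"
        using obtain_fresh[of "{i, m}"] n by auto
      have P: "p i \<in> {1..n}" "p j \<in> {1..n}" "p i \<noteq> p j" "p j \<noteq> p m"
        using p i1 j permutes_in_image permutes_inj inj_eq by metis+
      have Q: "q i \<in> {1..n}" "q j \<in> {1..n}" "q i \<noteq> q j"
        using q i1 j permutes_in_image permutes_inj inj_eq by metis+
      have "s (p i) (p j) \<otimes> g p = s (q i) (q j) \<otimes> g p"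
        using g(2)[OF p] g(2)[OF q] i1 j eq by metis
      then have "s (p i) (p j) = s (q i) (q j)"
        using H_carrier[OF g(1)[OF p]] H_carrier[OF s_in[OF P(1-3)]] H_carrier[OF s_in[OF Q]] by simp
      then have "{p i, p j} = {q i, q j}" using P Q by (intro inj) auto
      then show False using i m P by (auto simp: doubleton_eq_iff)
    qed
  qed
  then have "card {p. p permutes {1..n}} \<le> card H"
    using g finite_H by (intro card_inj_on_le) auto
  then show ?thesis by (simp add: card_permutations)
qed

text \<open>Row i of \<open>s\<close> plays the part of A_i. The two commutations are assumed for
  fixed labels only, since \<open>transfer_commute\<close> spreads them to every pattern of the same
  shape.\<close>

lemma constant_or_card_ge:
  assumes n: "4 \<le> n"
    and disj: "s 1 2 \<otimes> s 3 4 = s 3 4 \<otimes> s 1 2"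
    and row: "s 1 2 \<otimes> s 1 3 = s 1 3 \<otimes> s 1 2"
  shows "(\<exists>a. \<forall>i\<in>{1..n}. \<forall>j\<in>{1..n}. i \<noteq> j \<longrightarrow> s i j = a) \<or> 2 ^ (n - 2) * fact (n - 1) \<le> card H"
proof (cases "\<exists>i\<in>{1..n}. inj_on (s i) ({1..n} - {i})")
  case True
  then obtain i where i: "i \<in> {1..n}" "inj_on (s i) ({1..n} - {i})" by blast
  let ?S = "{1..n} - {i}"
  obtain e where e: "e \<in> {1..n}" "e \<notin> {i}" using obtain_fresh[of "{i}"] n by auto
  have "2 ^ (card ?S - 1) * fact (card ?S) \<le> card H"
  proof (rule card_ge_totally_symmetric[OF subgroup_H finite_H, where x = "s i" and p = e])
    show "s i ` ?S \<subseteq> H"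
    proof (rule image_subsetI)
      fix j assume "j \<in> ?S"
      then show "s i j \<in> H" using i(1) s_in[of i j] by auto
    qed
  next
    fix j k assume jk: "j \<in> ?S" "k \<in> ?S"
    show "s i j \<otimes> s i k = s i k \<otimes> s i j"
    proof (cases "j = k")
      case False
      then obtain p where p: "p permutes {1..n}" "map p [1, 2, 3] = [i, j, k]"
        using obtain_permutes[of "[1, 2, 3]" "[i, j, k]"] jk i n by auto
      then show ?thesis using transfer_commute[OF p(1) row] n by simp
    qed simp
  next
    fix q assume q: "q permutes ?S"
    \<comment> \<open>Extended by the identity, q fixes i, so its conjugator keeps row i in
      place.\<close>
    have "q permutes {1..n}" using permutes_subset[OF q] by blast
    then obtain g where "g \<in> H"
      "\<And>i j. i \<in> {1..n} \<Longrightarrow> j \<in> {1..n} \<Longrightarrow> i \<noteq> j \<Longrightarrow> g \<otimes> s i j = s (q i) (q j) \<otimes> g"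
      using conj_permutes by metis
    moreover have "q i = i" using permutes_not_in[OF q] by blast
    ultimately show "\<exists>g\<in>H. \<forall>j\<in>?S. g \<otimes> s i j = s i (q j) \<otimes> g"
      using i(1) by (metis DiffD1 DiffD2 singletonI)
  qed (use i e in auto)
  then show ?thesis using i by (simp add: numeral_2_eq_2)
next
  case False
  \<comment> \<open>Row i is sampled at column 1, or at column 2 when i = 1, to stay off the
    diagonal.\<close>
  define a where "a i = s i (if i = 1 then 2 else 1)" for i :: nat
  have a: "s i j = a i" if ij: "i \<in> {1..n}" "j \<in> {1..n}" "i \<noteq> j" for i j
  proof (cases "j = (if i = 1 then 2 else 1)")
    case j: False
    define k where "k = (if i = 1 then 2 else 1 :: nat)"
    have k: "k \<in> {1..n}" "k \<noteq> i" "k \<noteq> j" using n j by (auto simp: k_def)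
    \<comment> \<open>One coincidence within row i, moved by permutations fixing i, makes the whole
      row constant.\<close>
    obtain l m where lm: "l \<in> {1..n} - {i}" "m \<in> {1..n} - {i}" "l \<noteq> m" "s i l = s i m"
      using False ij unfolding inj_on_def by blast
    then obtain p where p: "p permutes {1..n}" "map p [i, l, m] = [i, j, k]"
      using obtain_permutes[of "[i, l, m]" "[i, j, k]"] ij k by auto
    then have "s i j = s i k"
      using transfer_eq[OF p(1) lm(4)] lm ij by simp
    then show ?thesis by (simp add: a_def k_def)
  qed (simp add: a_def)
  show ?thesis
  proof (cases "inj_on a {1..n}")
    case True
    have "2 ^ (card {1..n} - 1) * fact (card {1..n}) \<le> card H"
    proof (rule card_ge_totally_symmetric[OF subgroup_H finite_H, where x = a and p = 1])
      show "a ` {1..n} \<subseteq> H"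
        using s_in n by (auto simp: a_def)
    next
      fix i k assume ik: "i \<in> {1..n}" "k \<in> {1..n}"
      show "a i \<otimes> a k = a k \<otimes> a i"
      proof (cases "i = k")
        case False
        \<comment> \<open>Rows being constant, the columns are free: choosing them disjoint from
          each other and from i and k reduces the claim to disjoint pairs.\<close>
        obtain j where j: "j \<in> {1..n}" "j \<notin> {i, k}"
          using obtain_fresh[of "{i, k}"] n False by auto
        obtain l where l: "l \<in> {1..n}" "l \<notin> {i, k, j}"
          using obtain_fresh[of "{i, k, j}"] n False j by auto
        obtain p where p: "p permutes {1..n}" "map p [1, 2, 3, 4] = [i, j, k, l]"
          using obtain_permutes[of "[1, 2, 3, 4]" "[i, j, k, l]"] ik j l n False by auto
        then have "s i j \<otimes> s k l = s k l \<otimes> s i j"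
          using transfer_commute[OF p(1) disj] n by simp
        then show ?thesis using a ik j l by simp
      qed simp
    next
      fix q assume q: "q permutes {1..n}"
      then obtain g where g: "g \<in> H"
        "\<And>i j. i \<in> {1..n} \<Longrightarrow> j \<in> {1..n} \<Longrightarrow> i \<noteq> j \<Longrightarrow> g \<otimes> s i j = s (q i) (q j) \<otimes> g"
        using conj_permutes by metis
      have "g \<otimes> a i = a (q i) \<otimes> g" if i: "i \<in> {1..n}" for i
      proof -
        obtain j where j: "j \<in> {1..n}" "j \<notin> {i}"
          using obtain_fresh[of "{i}"] n by auto
        then have "q i \<in> {1..n}" "q j \<in> {1..n}" "q i \<noteq> q j"
          using q i permutes_in_image[OF q] permutes_inj[OF q] by (auto simp: inj_eq simp del: atLeastAtMost_iff)
        then show ?thesis using g(2)[of i j] a i j by simp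
      qed
      then show "\<exists>g\<in>H. \<forall>i\<in>{1..n}. g \<otimes> a i = a (q i) \<otimes> g" using g by blast
    qed (use n True in auto)
    moreover have "(2::nat) ^ (n - 2) * fact (n - 1) \<le> 2 ^ (n - 1) * fact n"
      by (intro mult_mono power_increasing fact_mono) auto
    ultimately show ?thesis by simp
  next
    case False
    then obtain i k where ik: "i \<in> {1..n}" "k \<in> {1..n}" "i \<noteq> k" "a i = a k"
      by (auto simp: inj_on_def)
    obtain j where j: "j \<in> {1..n}" "j \<notin> {i, k}"
      using obtain_fresh[of "{i, k}"] n ik by auto
    \<comment> \<open>Reading both rows in a common column turns the coincidence into an equation
      that can be relabelled to rows l and 1.\<close>
    have eq: "s i j = s k j" using a ik j by simp
    have "a l = a 1" if l: "l \<in> {1..n}" "l \<noteq> 1" for l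
    proof -
      obtain p where p: "p permutes {1..n}" "map p [i, k] = [l, 1]"
        using obtain_permutes[of "[i, k]" "[l, 1]"] ik l n by auto
      have "p j \<noteq> p i" "p j \<noteq> p k" using j permutes_inj[OF p(1)] by (auto simp: inj_eq)
      moreover have "p j \<in> {1..n}" using j permutes_in_image[OF p(1)] by blast
      ultimately show ?thesis
        using transfer_eq[OF p(1) eq] p j ik a[of l "p j"] a[of 1 "p j"] l n by auto
    qed
    then have "s i j = a 1" if "i \<in> {1..n}" "j \<in> {1..n}" "i \<noteq> j" for i j
      using a that by (cases "i = 1") auto
    then show ?thesis by blast
  qed
qed

end

section \<open>Homomorphisms from the virtual braid group\<close>

text \<open>Passing from k to k + 1 multiplies the left side by 3 (k + 2) and the right side by (2 k
  + 2)(2 k + 1), which is at least as large.\<close>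

lemma fact_double_ge: "1 \<le> k \<Longrightarrow> (k + 1) * 3 ^ (k - 1) * fact k \<le> (fact (2 * k) :: nat)"
proof (induction k rule: dec_induct)
  case (step k)
  let ?X = "(k + 1) * 3 ^ (k - 1) * fact k :: nat"
  obtain m where m: "k = Suc m" using step.hyps by (cases k) auto
  then have "3 * (k + 2) \<le> (2 * k + 2) * (2 * k + 1)" by (simp add: algebra_simps)
  then have le: "3 * (k + 2) * ?X \<le> (2 * k + 2) * (2 * k + 1) * fact (2 * k)"
    using step.IH by (rule mult_le_mono)
  have "(Suc k + 1) * 3 ^ (Suc k - 1) * fact (Suc k) = (k + 2) * (3 * 3 ^ (k - 1)) * ((k + 1) * (fact k :: nat))"
    using m by simp
  then have lhs: "(Suc k + 1) * 3 ^ (Suc k - 1) * fact (Suc k) = 3 * (k + 2) * ?X"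
    by (simp only: mult_ac)
  have "2 * Suc k = Suc (Suc (2 * k))" by simp
  then have rhs: "fact (2 * Suc k) = (2 * k + 2) * (2 * k + 1) * (fact (2 * k) :: nat)"
    by (simp only: fact_Suc) (simp add: algebra_simps)
  show ?case unfolding lhs rhs by (rule le)
qed (simp add: fact_numeral)

lemma fact_ge_virtual_bound:
  assumes "2 \<le> n"
  shows "(nat \<lfloor>real n / 2\<rfloor> + 1) * 3 ^ (nat \<lfloor>real n / 2\<rfloor> - 1) * fact (nat \<lceil>real n / 2\<rceil>)
    \<le> (fact n :: nat)"
proof (cases "even n")
  case True
  then obtain k where k: "n = 2 * k" by blast
  then have "\<lfloor>real n / 2\<rfloor> = int k" "\<lceil>real n / 2\<rceil> = int k" by auto
  then show ?thesis using fact_double_ge[of k] assms k by simp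
next
  case False
  then obtain k where k: "n = 2 * k + 1" by (metis oddE)
  then have "\<lfloor>real n / 2\<rfloor> = int k" "\<lceil>real n / 2\<rceil> = int (Suc k)"
    by (auto simp: floor_eq_iff ceiling_eq_iff field_simps)
  then have half: "nat \<lfloor>real n / 2\<rfloor> = k" "nat \<lceil>real n / 2\<rceil> = Suc k" by simp_all
  \<comment> \<open>Compared with n = 2 k, the odd case gains a factor k + 1 on the left and 2 k + 1
    on the right.\<close>
  have le: "(k + 1) * ((k + 1) * 3 ^ (k - 1) * fact k) \<le> (2 * k + 1) * (fact (2 * k) :: nat)"
    using assms k by (intro mult_le_mono fact_double_ge) auto
  have lhs: "(k + 1) * 3 ^ (k - 1) * fact (Suc k) = (k + 1) * ((k + 1) * 3 ^ (k - 1) * (fact k :: nat))"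
    by (simp only: fact_Suc Suc_eq_plus1[symmetric] of_nat_id mult_ac)
  have rhs: "fact n = (2 * k + 1) * (fact (2 * k) :: nat)" using k by simp
  show ?thesis unfolding half lhs rhs by (rule le)
qed

section \<open>Evaluation of braid words in the finite group\<close>

locale vB_hom = group G for G (structure) +
  fixes n :: nat and \<phi> :: "vbraid \<Rightarrow> 'a"
  assumes hom: "\<phi> \<in> hom (vB n) G" and finite_carrier: "finite (carrier G)"
begin

definition val :: "vgen gword \<Rightarrow> 'a" where
  "val w = \<phi> (vB_word n w)"

definition H :: "'a set" where
  "H = \<phi> ` carrier (vB n)"

abbreviation S :: "nat \<Rightarrow> 'a" where "S k \<equiv> val [sg k]"
abbreviation T :: "nat \<Rightarrow> 'a" where "T k \<equiv> val [tu k]"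

sublocale phi: group_hom "vB n" G \<phi>
  by (intro group_hom.intro group_hom_axioms.intro group_vB group_axioms hom)

lemma gens_iff [simp]:
  "Sigma_gen k \<in> vB_gens n \<longleftrightarrow> k \<in> {1..<n}" "Tau_gen k \<in> vB_gens n \<longleftrightarrow> k \<in> {1..<n}"
  by (auto simp: vB_gens_def)

lemma H_eq: "H = val ` gwords (vB_gens n)"
  by (auto simp: H_def val_def vB_def vB_word_def carrier_presented_group)

lemma subgroup_H: "subgroup H G"
  unfolding H_def by (rule phi.img_is_subgroup)

lemma finite_H: "finite H"
  using subgroup_H finite_carrier subgroup.subset finite_subset by metis

lemma val_in_H: "w \<in> gwords (vB_gens n) \<Longrightarrow> val w \<in> H"
  by (simp add: H_eq)

lemma H_closed: "h \<in> H \<Longrightarrow> h \<in> carrier G"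
  using subgroup_H subgroup.mem_carrier by metis

lemma val_closed: "w \<in> gwords (vB_gens n) \<Longrightarrow> val w \<in> carrier G"
  using val_in_H H_closed by blast

lemma gen_closed: "k \<in> {1..<n} \<Longrightarrow> S k \<in> carrier G" "k \<in> {1..<n} \<Longrightarrow> T k \<in> carrier G"
  by (simp_all add: val_closed)

lemma val_append:
  assumes "u \<in> gwords (vB_gens n)" "v \<in> gwords (vB_gens n)"
  shows "val (u @ v) = val u \<otimes> val v"
  using phi.hom_mult[OF vB_word_in_carrier[OF assms(1)] vB_word_in_carrier[OF assms(2)]] assms
  by (simp add: val_def vB_def vB_word_def mult_presented_group)

lemma val_Nil: "val [] = \<one>"
  using phi.hom_one by (simp add: val_def vB_def vB_word_def one_presented_group)

lemma val_Cons:
  assumes "snd l \<in> vB_gens n" "w \<in> gwords (vB_gens n)" "w \<noteq> []"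
  shows "val (l # w) = val [l] \<otimes> val w"
  using val_append[of "[l]" w] assms by simp

lemma val_pres_rel: "(u, v) \<in> pres_rel (vB_gens n) (vB_rels n) \<Longrightarrow> val u = val v"
  using pres_rel_gwords pres_class_eq_iff by (metis val_def vB_word_def)

lemma val_rel: "(u, v) \<in> vB_rels n \<Longrightarrow> val u = val v"
  using vB_rels_gwords pres_relation val_pres_rel by metis

lemma val_inverse:
  assumes "x \<in> vB_gens n"
  shows "val [(False, x)] = inv (val [(True, x)])"
proof -
  have "val [(False, x), (True, x)] = \<one>"
    using val_pres_rel[OF pres_cancel[OF assms, of False]] val_Nil by simp
  then have "val [(False, x)] \<otimes> val [(True, x)] = \<one>"
    using assms by (simp add: val_Cons)
  then show ?thesis using assms by (intro inv_equality[symmetric]) (auto intro: val_closed)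
qed

lemma far_iff: "far n k l \<longleftrightarrow> k \<in> {1..<n} \<and> l \<in> {1..<n} \<and> (Suc k < l \<or> Suc l < k)"
  by (auto simp: far_def)

lemma T_T: "k \<in> {1..<n} \<Longrightarrow> T k \<otimes> T k = \<one>"
  using val_rel[of "[tu k, tu k]" "[]"] by (auto simp: vB_rels_def val_Cons val_Nil)

lemma S_S_far: "far n k l \<Longrightarrow> S k \<otimes> S l = S l \<otimes> S k"
  using val_rel[of "[sg k, sg l]" "[sg l, sg k]"] by (auto simp: vB_rels_def far_iff val_Cons)

lemma T_T_far: "far n k l \<Longrightarrow> T k \<otimes> T l = T l \<otimes> T k"
  using val_rel[of "[tu k, tu l]" "[tu l, tu k]"] by (auto simp: vB_rels_def far_iff val_Cons)

lemma S_T_far: "far n k l \<Longrightarrow> S k \<otimes> T l = T l \<otimes> S k"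
  using val_rel[of "[sg k, tu l]" "[tu l, sg k]"] by (auto simp: vB_rels_def far_iff val_Cons)

lemma T_braid:
  assumes "1 \<le> k" "Suc k < n"
  shows "T k \<otimes> (T (Suc k) \<otimes> T k) = T (Suc k) \<otimes> (T k \<otimes> T (Suc k))"
  using val_rel[of "[tu k, tu (k + 1), tu k]" "[tu (k + 1), tu k, tu (k + 1)]"] assms
  by (auto simp: vB_rels_def val_Cons)

lemma T_S_mixed:
  assumes "1 \<le> k" "Suc k < n"
  shows "T (Suc k) \<otimes> (S k \<otimes> T (Suc k)) = T k \<otimes> (S (Suc k) \<otimes> T k)"
  using val_rel[of "[tu (k + 1), sg k, tu (k + 1)]" "[tu k, sg (k + 1), tu k]"] assms
  by (auto simp: vB_rels_def val_Cons)

lemma T_cancel: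
  "k \<in> {1..<n} \<Longrightarrow> y \<in> carrier G \<Longrightarrow> T k \<otimes> (T k \<otimes> y) = y"
  using T_T[of k] gen_closed[of k] by (simp flip: m_assoc)

text \<open>This is conjugation by \<open>T k\<close>, which is its own inverse for k in
  range.\<close>

definition c :: "nat \<Rightarrow> 'a \<Rightarrow> 'a" where
  "c k y = T k \<otimes> y \<otimes> T k"

sublocale coxeter_action n H c
proof
  fix k y assume "k \<in> {1..<n}" "y \<in> H"
  then show "c k y \<in> H"
    using val_in_H[of "[tu k]"] subgroup_H by (auto simp: c_def intro!: subgroup.m_closed)
  show "c k (c k y) = y"
    using \<open>k \<in> {1..<n}\<close> H_closed[OF \<open>y \<in> H\<close>] T_T T_cancel gen_closed
    by (simp add: c_def m_assoc)
next
  fix k l y assume kl: "k \<in> {1..<n}" "l \<in> {1..<n}" "Suc k < l" and y: "y \<in> H"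
  have G: "T k \<in> carrier G" "T l \<in> carrier G" "y \<in> carrier G"
    using kl y H_closed gen_closed by auto
  have far: "T k \<otimes> T l = T l \<otimes> T k" using kl T_T_far by (simp add: far_iff)
  have "c k (c l y) = (T k \<otimes> T l) \<otimes> y \<otimes> (T l \<otimes> T k)" using G by (simp add: c_def m_assoc)
  also have "\<dots> = (T l \<otimes> T k) \<otimes> y \<otimes> (T k \<otimes> T l)" using far by simp
  also have "\<dots> = c l (c k y)" using G by (simp add: c_def m_assoc)
  finally show "c k (c l y) = c l (c k y)" .
next
  fix k y assume k: "1 \<le> k" "Suc k < n" and y: "y \<in> H"
  let ?l = "Suc k"
  have G: "T k \<in> carrier G" "T ?l \<in> carrier G" "y \<in> carrier G"
    using k y H_closed gen_closed by auto
  have "c k (c ?l (c k y)) = (T k \<otimes> (T ?l \<otimes> T k)) \<otimes> y \<otimes> (T k \<otimes> (T ?l \<otimes> T k))"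
    using G by (simp add: c_def m_assoc)
  also have "\<dots> = (T ?l \<otimes> (T k \<otimes> T ?l)) \<otimes> y \<otimes> (T ?l \<otimes> (T k \<otimes> T ?l))"
    using T_braid[OF k] by simp
  also have "\<dots> = c ?l (c k (c ?l y))" using G by (simp add: c_def m_assoc)
  finally show "c k (c ?l (c k y)) = c ?l (c k (c ?l y))" .
qed

lemma symmetric_pairs_pair:
  assumes "admissible x"
  shows "symmetric_pairs G n H T (pair x)"
proof (intro symmetric_pairs.intro symmetric_pairs_axioms.intro group_axioms subgroup_H finite_H)
  show "T k \<in> H" if "k \<in> {1..<n}" for k using that by (simp add: val_in_H)
  show "pair x i j \<in> H" if "i \<in> {1..n}" "j \<in> {1..n}" "i \<noteq> j" for i j
    using pair_closed[OF assms] that by simp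
next
  fix k i j
  assume k: "k \<in> {1..<n}" and ij: "i \<in> {1..n}" "j \<in> {1..n}" "i \<noteq> j"
  have p: "pair x i j \<in> H" using pair_closed[OF assms ij] .
  have "T k \<otimes> pair x i j = c k (pair x i j) \<otimes> T k"
    using k T_T gen_closed H_closed[OF p] by (simp add: c_def m_assoc)
  then show "T k \<otimes> pair x i j = pair x (transpose k (Suc k) i) (transpose k (Suc k) j) \<otimes> T k"
    using pair_transpose[OF assms ij k] by simp
qed

lemma c_eqI:
  "k \<in> {1..<n} \<Longrightarrow> y \<in> carrier G \<Longrightarrow> T k \<otimes> y = y \<otimes> T k \<Longrightarrow> c k y = y"
  using T_T gen_closed by (simp add: c_def m_assoc)

lemma admissible_T: "admissible T"
  unfolding admissible_def
proof (intro conjI ballI allI impI)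
  fix i k assume "i \<in> {1..<n}" "k \<in> {1..<n}" "Suc i < k \<or> Suc k < i"
  then show "c k (T i) = T i"
    using T_T_far by (intro c_eqI gen_closed) (auto simp: far_iff)
next
  fix i assume "1 \<le> i \<and> Suc i < n"
  then show "c (Suc i) (T i) = c i (T (Suc i))"
    using T_braid[of i] gen_closed by (simp add: c_def m_assoc)
qed (simp add: val_in_H)

text \<open>The image of \<sigma>_{k,k+1}.\<close>

definition TS :: "nat \<Rightarrow> 'a" where
  "TS k = T k \<otimes> S k"

lemma admissible_TS: "admissible TS"
  unfolding admissible_def
proof (intro conjI ballI allI impI)
  fix i assume "i \<in> {1..<n}"
  then show "TS i \<in> H"
    unfolding TS_def by (intro subgroup.m_closed[OF subgroup_H] val_in_H) auto
next
  fix i k assume ik: "i \<in> {1..<n}" "k \<in> {1..<n}" "Suc i < k \<or> Suc k < i"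
  then have G: "T i \<in> carrier G" "S i \<in> carrier G" "T k \<in> carrier G" using gen_closed by auto
  have "T k \<otimes> T i = T i \<otimes> T k" "S i \<otimes> T k = T k \<otimes> S i"
    using ik T_T_far S_T_far by (auto simp: far_iff)
  then have "T k \<otimes> TS i = TS i \<otimes> T k" using G by (metis TS_def m_assoc)
  then show "c k (TS i) = TS i" using ik G by (intro c_eqI) (auto simp: TS_def)
next
  fix i assume "1 \<le> i \<and> Suc i < n"
  then have i: "1 \<le> i" "Suc i < n" by auto
  let ?j = "Suc i"
  have G: "T i \<in> carrier G" "S i \<in> carrier G" "T ?j \<in> carrier G" "S ?j \<in> carrier G"
    using i gen_closed by auto
  \<comment> \<open>Inserting the square of \<open>T ?j\<close> creates the left side of the mixed
    relation; the braid relation for \<open>T\<close> and a cancellation then finish.\<close>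
  have "c ?j (TS i) = T ?j \<otimes> (T i \<otimes> (T ?j \<otimes> (T ?j \<otimes> (S i \<otimes> T ?j))))"
    using G i T_cancel[of ?j] by (simp add: c_def TS_def m_assoc)
  also have "\<dots> = T ?j \<otimes> (T i \<otimes> T ?j) \<otimes> (T i \<otimes> (S ?j \<otimes> T i))"
    using G T_S_mixed[OF i] by (simp add: m_assoc)
  also have "\<dots> = T i \<otimes> (T ?j \<otimes> T i) \<otimes> (T i \<otimes> (S ?j \<otimes> T i))"
    using T_braid[OF i] by simp
  also have "\<dots> = c i (TS ?j)"
    using G i T_cancel[of i] by (simp add: c_def TS_def m_assoc)
  finally show "c ?j (TS i) = c i (TS ?j)" .
qed

lemma val_conj:
  assumes "set L \<subseteq> {1..<n}" "w \<in> gwords (vB_gens n)" "w \<noteq> []"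
  shows "val (map tu L @ w @ map tu (rev L)) = foldr c L (val w)"
  using assms(1)
proof (induction L)
  case (Cons k L)
  have L: "map tu L \<in> gwords (vB_gens n)" "map tu (rev L) \<in> gwords (vB_gens n)"
    using Cons.prems by (auto simp: gwords_def)
  have "val ([tu k] @ (map tu L @ w @ map tu (rev L)) @ [tu k])
      = T k \<otimes> val (map tu L @ w @ map tu (rev L)) \<otimes> T k"
    using L Cons.prems assms val_closed by (subst val_append, simp, simp)+ (simp add: m_assoc)
  then show ?case using Cons by (simp add: c_def)
qed simp

text \<open>Each word conjugates \<sigma>_{k,k+1} or \<sigma>_{k+1,k} by a string of \<tau>s. This
  identifies the abstract labels with the elements that make up the sets A_i.\<close>

lemma val_sigma_pair_word:
  assumes "i \<in> {1..n}" "j \<in> {1..n}" "i \<noteq> j"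
  shows "val (sigma_pair_word i j) = pair TS i j"
proof (cases "i < j")
  case True
  then have j: "j - 1 \<in> {1..<n}" "set [i..<j - 1] \<subseteq> {1..<n}" using assms by auto
  have "val (sigma_pair_word i j) = foldr c [i..<j - 1] (val [tu (j - 1), sg (j - 1)])"
    using val_conj[OF j(2), of "[tu (j - 1), sg (j - 1)]"] True j(1)
    by (simp add: sigma_pair_word_def)
  also have "val [tu (j - 1), sg (j - 1)] = TS (j - 1)"
    using j(1) by (simp add: val_Cons TS_def)
  finally show ?thesis using True by (simp add: pair_def up_def)
next
  case False
  then have ji: "1 \<le> j" "j < i" "i \<le> n" "j \<in> {1..<n}" using assms by auto
  \<comment> \<open>Conjugating \<tau>_j \<sigma>_j by \<tau>_j gives \<sigma>_j \<tau>_j, which is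
    \<sigma>_{j+1,j}.\<close>
  have "flip TS j = val [sg j, tu j]"
    using ji T_cancel gen_closed by (simp add: flip_def c_def TS_def val_Cons m_assoc)
  then show ?thesis
    using val_conj[of "rev [Suc j..<i]" "[sg j, tu j]"] ji
      pair_greater_conv[OF admissible_TS ji(1-3)]
    by (auto simp: sigma_pair_word_def)
qed

lemma sigma_pair_word_gwords:
  assumes "i \<in> {1..n}" "j \<in> {1..n}" "i \<noteq> j"
  shows "sigma_pair_word i j \<in> gwords (vB_gens n)"
proof (cases "i < j")
  case True
  then have "j - 1 \<in> {1..<n}" "set [i..<j - 1] \<subseteq> {1..<n}" using assms by auto
  then show ?thesis using True by (auto simp: sigma_pair_word_def gwords_def simp del: set_upt)
next
  case False
  then have "j \<in> {1..<n}" "set [j + 1..<i] \<subseteq> {1..<n}" using assms by auto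
  then show ?thesis using False by (auto simp: sigma_pair_word_def gwords_def simp del: set_upt)
qed

text \<open>The generators generate \<open>H\<close>, so passing from generators to \<open>H\<close>
  in one argument and then in the other suffices.\<close>

lemma H_commute:
  assumes gens: "\<And>x y. x \<in> vB_gens n \<Longrightarrow> y \<in> vB_gens n
    \<Longrightarrow> val [(True, x)] \<otimes> val [(True, y)] = val [(True, y)] \<otimes> val [(True, x)]"
    and ab: "a \<in> H" "b \<in> H"
  shows "a \<otimes> b = b \<otimes> a"
proof -
  let ?E = "(\<lambda>x. val [(True, x)]) ` vB_gens n"
  have E: "?E \<subseteq> carrier G" by (auto intro: val_closed)
  have gen: "h \<in> generate G ?E" if "h \<in> H" for h
  proof -
    have "val w \<in> generate G ?E" if "w \<in> gwords (vB_gens n)" for w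
      using that
    proof (induction w)
      case Nil
      then show ?case by (simp add: val_Nil generate.one)
    next
      case (Cons l w)
      obtain d x where l: "l = (d, x)" by force
      have "val [l] \<in> generate G ?E"
        using Cons.prems l val_inverse[of x] by (cases d) (auto intro: generate.incl generate.inv)
      moreover have "val (l # w) = val [l] \<otimes> val w"
        using Cons.prems val_append[of "[l]" w] by simp
      ultimately show ?case using Cons by (auto intro: generate.eng)
    qed
    then show ?thesis using that H_eq by auto
  qed
  have "e \<otimes> b = b \<otimes> e" if "e \<in> ?E" for e
    using that gens E by (intro commute_generate[OF E _ _ gen[OF ab(2)]]) auto
  then show ?thesis
    using ab H_closed by (intro commute_generate[OF E _ _ gen[OF ab(1)], symmetric]) auto
qed

section \<open>The alternatives for the size of the image\<close>

lemma abelian_or_card_ge: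
  assumes n: "5 \<le> n"
  shows "abelian_on (carrier (vB n)) G \<phi> \<or> fact n \<le> card H"
proof (cases "\<exists>k\<in>{1..<n - 1}. T k \<noteq> T (Suc k)")
  case True
  interpret sp: symmetric_pairs G n H T "pair T" by (rule symmetric_pairs_pair[OF admissible_T])
  from True obtain k where k: "k \<in> {1..<n - 1}" "T k \<noteq> T (Suc k)" by blast
  \<comment> \<open>An involution is fixed under conjugation by itself, so \<open>pair T\<close>
    depends only on the unordered pair of labels.\<close>
  have flip: "flip T m = T m" if "m \<in> {1..<n}" for m
    using that T_T gen_closed by (simp add: flip_def c_def)
  have "fact n \<le> card H"
  proof (rule sp.card_ge_fact[OF _ n k(1)])
    fix i j assume "i \<in> {1..n}" "j \<in> {1..n}" "i \<noteq> j"
    then consider "i < j" "flip T (j - 1) = T (j - 1)" | "j < i" "flip T (i - 1) = T (i - 1)"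
      using flip[of "j - 1"] flip[of "i - 1"] by fastforce
    then show "pair T i j = pair T j i" by cases (simp_all add: pair_def up_def)
  qed (use k in \<open>simp add: pair_def up_base\<close>)
  then show ?thesis ..
next
  case False
  have T: "T k = T 1" if "k \<in> {1..<n}" for k
  proof -
    have "1 \<le> k" "k < n" using that by auto
    then show ?thesis
    proof (induction k rule: dec_induct)
      case (step k)
      then have "k \<in> {1..<n - 1}" by auto
      then have "T k = T (Suc k)" using False by blast
      then show ?case using step by simp
    qed simp
  qed
  have S: "S k = S 1" if "k \<in> {1..<n}" for k
  proof -
    have "1 \<le> k" "k < n" using that by auto
    then show ?thesis
    proof (induction k rule: dec_induct)
      case (step k)
      \<comment> \<open>With all \<open>T k\<close> equal, both sides of the mixed relation carry
        the same outer factors, which cancel.\<close>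
      then have "T 1 \<otimes> (S k \<otimes> T 1) = T 1 \<otimes> (S (Suc k) \<otimes> T 1)"
        using T_S_mixed[of k] T[of k] T[of "Suc k"] by simp
      then show ?case using step gen_closed by simp
    qed simp
  qed
  \<comment> \<open>\<open>S 1\<close> commutes with the distant \<open>T 3\<close>, which equals
    \<open>T 1\<close>.\<close>
  have ST: "S 1 \<otimes> T 1 = T 1 \<otimes> S 1" using S_T_far[of 1 3] T[of 3] n by (simp add: far_iff)
  have gen: "val [(True, x)] \<in> {S 1, T 1}" if "x \<in> vB_gens n" for x
  proof (cases x)
    case (Sigma_gen k)
    then show ?thesis using S[of k] that by simp
  next
    case (Tau_gen k)
    then show ?thesis using T[of k] that by simp
  qed
  have gens: "val [(True, x)] \<otimes> val [(True, y)] = val [(True, y)] \<otimes> val [(True, x)]"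
    if "x \<in> vB_gens n" "y \<in> vB_gens n" for x y
    using gen[OF that(1)] gen[OF that(2)] ST by auto
  have "comm_group (G\<lparr>carrier := H\<rparr>)"
    using H_commute[OF gens] subgroup_imp_group[OF subgroup_H]
    by (intro group.group_comm_groupI) auto
  then show ?thesis by (simp add: abelian_on_def H_def)
qed

lemma pairs_constant_or_card_ge:
  assumes n: "5 \<le> n" and welded: "val [tu 1, sg 2, sg 1] = val [sg 2, sg 1, tu 2]"
  shows "(\<exists>a. \<forall>i\<in>{1..n}. \<forall>j\<in>{1..n}. i \<noteq> j \<longrightarrow> pair TS i j = a)
    \<or> 2 ^ (n - 2) * fact (n - 1) \<le> card H"
proof -
  interpret sp: symmetric_pairs G n H T "pair TS"
    by (rule symmetric_pairs_pair[OF admissible_TS])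
  have G: "T 1 \<in> carrier G" "T 2 \<in> carrier G" "T 3 \<in> carrier G"
    "S 1 \<in> carrier G" "S 2 \<in> carrier G" "S 3 \<in> carrier G"
    using gen_closed n by auto
  note cancel = T_cancel[of 1] T_cancel[of 2] T_T[of 1] T_T[of 2]
  have s12: "pair TS 1 2 = T 1 \<otimes> S 1"
    using up_base[of TS 1] by (simp add: pair_def TS_def)
  have s34: "pair TS 3 4 = T 3 \<otimes> S 3"
    using up_base[of TS 3] by (simp add: pair_def TS_def)
  have "pair TS 1 3 = c 1 (TS 2)"
    using up_step[of 1 2 TS] up_base[of TS 2] by (simp add: pair_def numeral_2_eq_2)
  then have s13: "pair TS 1 3 = T 1 \<otimes> (T 2 \<otimes> (S 2 \<otimes> T 1))"
    using G by (simp add: c_def TS_def m_assoc)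
  \<comment> \<open>A second form of the same element, from admissibility: it puts
    \<open>T 2 \<otimes> T 1\<close> next to \<open>S 1\<close> in the product computed
    below.\<close>
  have s13': "pair TS 1 3 = T 2 \<otimes> (T 1 \<otimes> (S 1 \<otimes> T 2))"
    using \<open>pair TS 1 3 = c 1 (TS 2)\<close> admissibleD(3)[OF admissible_TS, of 1] G n
    by (simp add: c_def TS_def m_assoc numeral_2_eq_2)
  have disj: "pair TS 1 2 \<otimes> pair TS 3 4 = pair TS 3 4 \<otimes> pair TS 1 2"
  proof -
    have "T 1 \<otimes> T 3 = T 3 \<otimes> T 1" "S 1 \<otimes> S 3 = S 3 \<otimes> S 1" "S 1 \<otimes> T 3 = T 3 \<otimes> S 1"
      "S 3 \<otimes> T 1 = T 1 \<otimes> S 3"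
      using n T_T_far[of 1 3] S_S_far[of 1 3] S_T_far[of 1 3] S_T_far[of 3 1]
      by (auto simp: far_iff)
    then have "(T 1 \<otimes> S 1) \<otimes> T 3 = T 3 \<otimes> (T 1 \<otimes> S 1)" "(T 1 \<otimes> S 1) \<otimes> S 3 = S 3 \<otimes> (T 1 \<otimes> S 1)"
      using G by (metis m_assoc)+
    then show ?thesis unfolding s12 s34 using G m_assoc[of "T 1 \<otimes> S 1"] m_assoc[of "T 3"]
        m_assoc[of "T 3" "T 1 \<otimes> S 1" "S 3"] by (metis m_closed)
  qed
  have "T 2 \<otimes> (S 1 \<otimes> T 2) = T 1 \<otimes> (S 2 \<otimes> T 1)"
    using T_S_mixed[of 1] n by (simp add: numeral_2_eq_2)
  then have "T 2 \<otimes> (T 2 \<otimes> (S 1 \<otimes> T 2)) \<otimes> T 1 = T 2 \<otimes> (T 1 \<otimes> (S 2 \<otimes> T 1)) \<otimes> T 1"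
    by simp
  \<comment> \<open>In this form the mixed relation moves \<open>S 1\<close> past
    \<open>T 2 \<otimes> T 1\<close> and turns it into \<open>S 2\<close>, ready for the welded
    relation.\<close>
  then have mixed: "S 1 \<otimes> (T 2 \<otimes> T 1) = T 2 \<otimes> (T 1 \<otimes> S 2)"
    using G cancel n by (simp add: m_assoc)
  have welded': "T 1 \<otimes> (S 2 \<otimes> S 1) = S 2 \<otimes> (S 1 \<otimes> T 2)"
    using welded n by (simp add: val_Cons)
  have "pair TS 1 2 \<otimes> pair TS 1 3 = T 1 \<otimes> (S 1 \<otimes> (T 2 \<otimes> T 1)) \<otimes> (S 1 \<otimes> T 2)"
    unfolding s12 s13' using G by (simp add: m_assoc)
  also have "\<dots> = T 1 \<otimes> (T 2 \<otimes> (T 1 \<otimes> (S 2 \<otimes> S 1) \<otimes> T 2))"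
    unfolding mixed using G by (simp add: m_assoc)
  also have "\<dots> = T 1 \<otimes> (T 2 \<otimes> (S 2 \<otimes> S 1))"
    unfolding welded' using G cancel n by (simp add: m_assoc)
  also have "\<dots> = pair TS 1 3 \<otimes> pair TS 1 2"
    unfolding s12 s13 using G cancel n by (simp add: m_assoc)
  finally show ?thesis using sp.constant_or_card_ge disj n by simp
qed

text \<open>The relator lies in the kernel of \<open>wB_proj n\<close>, so a homomorphism factoring
  through \<open>wB n\<close> sends it to the identity.\<close>

lemma welded_relation:
  assumes ind: "induced_on_wB n G \<phi> \<psi>" and n: "3 \<le> n"
  shows "val [tu 1, sg 2, sg 1] = val [sg 2, sg 1, tu 2]"
proof -
  let ?u = "[tu 1, sg 2, sg 1]" and ?v = "[sg 2, sg 1, tu 2]"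
  let ?r = "vB_word n ?u \<otimes>\<^bsub>vB n\<^esub> inv\<^bsub>vB n\<^esub> vB_word n ?v"
  have uv: "?u \<in> gwords (vB_gens n)" "?v \<in> gwords (vB_gens n)" using n by auto
  note uvc = vB_word_in_carrier[OF uv(1)] vB_word_in_carrier[OF uv(2)]
  have "?r \<in> welded_relators n"
    unfolding welded_relators_def using n by (intro CollectI exI[of _ 1]) (auto simp: numeral_2_eq_2)
  moreover have rc: "?r \<in> carrier (vB n)" using uvc by simp
  \<comment> \<open>Conjugation by the identity exhibits the relator as a generator of the normal
    closure.\<close>
  ultimately have "\<one>\<^bsub>vB n\<^esub> \<otimes>\<^bsub>vB n\<^esub> ?r \<otimes>\<^bsub>vB n\<^esub> inv\<^bsub>vB n\<^esub> \<one>\<^bsub>vB n\<^esub> \<in> welded_kernel n"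
    unfolding welded_kernel_def normal_closure_def
    by (intro generate.incl CollectI exI[of _ "\<one>\<^bsub>vB n\<^esub>"] exI[of _ ?r] conjI) auto
  then have r: "?r \<in> welded_kernel n" using rc by simp
  have sub: "subgroup (welded_kernel n) (vB n)"
    using welded_kernel_normal normal_imp_subgroup by blast
  have "wB_proj n ?r = wB_proj n \<one>\<^bsub>vB n\<^esub>"
    using group.coset_join2[OF group_vB rc sub r] group.coset_mult_one[OF group_vB subgroup.subset[OF sub]]
    by (simp add: wB_proj_def)
  moreover have "\<psi> (wB_proj n x) = \<phi> x" if "x \<in> carrier (vB n)" for x
    using ind that by (simp add: induced_on_wB_def)
  ultimately have "\<phi> ?r = \<phi> \<one>\<^bsub>vB n\<^esub>"
    using rc phi.G.one_closed by metis
  then have "val ?u \<otimes> inv val ?v = \<one>" using uvc by (simp add: val_def)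
  moreover have "val ?u = val ?u \<otimes> inv val ?v \<otimes> val ?v"
    using val_closed[OF uv(1)] val_closed[OF uv(2)] by (simp add: m_assoc)
  ultimately show ?thesis using val_closed[OF uv(2)] by simp
qed

lemma cyclic_or_card_ge:
  assumes n: "5 \<le> n" and ind: "induced_on_wB n G \<phi> \<psi>"
  shows "cyclic_on (PwB n) G \<psi> \<or> 2 ^ (n - 2) * fact (n - 1) \<le> card H"
proof (rule disjCI)
  assume "\<not> 2 ^ (n - 2) * fact (n - 1) \<le> card H"
  then obtain a where a: "\<And>i j. i \<in> {1..n} \<Longrightarrow> j \<in> {1..n} \<Longrightarrow> i \<noteq> j \<Longrightarrow> pair TS i j = a"
    using pairs_constant_or_card_ge[OF n welded_relation[OF ind]] n by auto
  interpret psi: group_hom "wB n" G \<psi>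
    using ind group_wB
    by (intro group_hom.intro group_hom_axioms.intro group_axioms) (auto simp: induced_on_wB_def)
  let ?E = "{sigma_pair n i j | i j. i \<in> {1..n} \<and> j \<in> {1..n} \<and> i \<noteq> j}"
  have psi: "\<psi> (sigma_pair n i j) = a" "sigma_pair n i j \<in> carrier (wB n)"
    if ij: "i \<in> {1..n}" "j \<in> {1..n}" "i \<noteq> j" for i j
  proof -
    have w: "vB_word n (sigma_pair_word i j) \<in> carrier (vB n)"
      using sigma_pair_word_gwords[OF ij] by (rule vB_word_in_carrier)
    then show "\<psi> (sigma_pair n i j) = a"
      using ind val_sigma_pair_word[OF ij] a[OF ij]
      by (simp add: induced_on_wB_def sigma_pair_def val_def)
    show "sigma_pair n i j \<in> carrier (wB n)"
      using w wB_proj_surj by (auto simp: sigma_pair_def)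
  qed
  have "sigma_pair n 1 2 \<in> ?E" using n by force
  \<comment> \<open>All generators of the pure group share one image, so the image of that group is
    generated by \<open>a\<close>.\<close>
  then have "\<psi> ` ?E = {a}" using psi(1) by (auto intro!: image_eqI)
  then have img: "\<psi> ` PwB n = generate G {a}"
    unfolding PwB_def using psi(2) by (subst psi.generate_img[symmetric]) auto
  have aG: "a \<in> carrier G" using psi(1)[of 1 2] psi(2)[of 1 2] n by auto
  have "cyclic_group (subgroup_generated G {a})" by (rule cyclic_group_generated)
  then show "cyclic_on (PwB n) G \<psi>"
    using aG by (simp add: cyclic_on_def img subgroup_generated_def)
qed

end

theorem theorem3:
  fixes n :: nat and G :: "('g, 'm) monoid_scheme" and \<phi> :: "vbraid \<Rightarrow> 'g"
  assumes "n > 5"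
    and "group G"
    and "finite (carrier G)"
    and "\<phi> \<in> hom (vB n) G"
  shows
    "abelian_on (carrier (vB n)) G \<phi>
   \<or> (\<exists>\<psi>. induced_on_wB n G \<phi> \<psi> \<and>
        (cyclic_on (PwB n) G \<psi>
         \<or> card (\<phi> ` carrier (vB n)) \<ge> 2 ^ (n - 2) * fact (n - 1)
         \<or> ((\<exists>a :: nat \<Rightarrow> 'g.
               (\<forall>i\<in>{1..n}. \<not> splits \<psi> (A_set n i) \<and> \<psi> ` A_set n i = {a i}) \<and>
               (\<forall>i\<in>{1..n}. \<forall>j\<in>{1..n}. i \<noteq> j \<longrightarrow> a i [^]\<^bsub>G\<^esub> (2::nat) \<noteq> a j [^]\<^bsub>G\<^esub> (2::nat)))
            \<and> card (\<phi> ` carrier (vB n)) \<ge>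
                (nat \<lfloor>real n / 2\<rfloor> + 1) * 3 ^ (nat \<lfloor>real n / 2\<rfloor> - 1) * fact (nat \<lceil>real n / 2\<rceil>))))
   \<or> (\<not> factors_through_wB n G \<phi> \<and>
        card (\<phi> ` carrier (vB n)) \<ge>
          (nat \<lfloor>real n / 2\<rfloor> + 1) * 3 ^ (nat \<lfloor>real n / 2\<rfloor> - 1) * fact (nat \<lceil>real n / 2\<rceil>))"
proof -
  interpret vB_hom G n \<phi>
    using assms by (simp add: vB_hom_def vB_hom_axioms_def)
  \<comment> \<open>The factorial bound is carried along only when no induced map exists; with an
    induced map the welded alternatives decide.\<close>
  consider "abelian_on (carrier (vB n)) G \<phi>" | \<psi> where "induced_on_wB n G \<phi> \<psi>"
    | "\<not> factors_through_wB n G \<phi>" "fact n \<le> card (\<phi> ` carrier (vB n))"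
    using abelian_or_card_ge assms(1) by (auto simp: factors_through_wB_def H_def)
  then show ?thesis
  proof cases
    case 2
    then show ?thesis using cyclic_or_card_ge[of \<psi>] assms(1) unfolding H_def by auto
  next
    case 3
    then show ?thesis using fact_ge_virtual_bound[of n] assms(1) by linarith
  qed simp
qed

end
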